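(* Let $m,n\ge1$ be integers and let the knots satisfy $$t_{-m}=t_{-m+1}=\dots=t_0<t_1<\dots<t_{n-1}<t_n=t_{n+1}=\dots=t_{n+m}.$$ Then the $n(m+1)^2$ adjusted Bernstein–Bézier coefficients $b_k^{(i,j)}$ of the B-spline functions $N_{mi}$ over the knot spans $[t_j,t_{j+1})$, for $j=0,1,\dots,n-1$, $i=j-m,j-m+1,\dots,j$ and $k=0,1,\dots,m$, can be computed with computational complexity $O(nm^2)$ in the following way (in particular, the coefficients satisfy the formulas below). 1. For $j=0,1,\dots,n-1$: $$b_k^{(j,j)}=0\ (k=0,1,\dots,m-1),\qquad b_m^{(j,j)}=\frac{(t_{j+1}-t_j)^{m-1}}{\prod_{k=2}^m(t_{j+k}-t_j)},$$ $$b_0^{(j-m,j)}=\frac{(t_{j+1}-t_j)^{m-1}}{\prod_{k=2}^m(t_{j+1}-t_{j+1-k})},\qquad b_k^{(j-m,j)}=0\ (k=1,2,\dots,m).$$ 2. For $j=n-1$ and $i=n-2,n-3,\dots,n-m$ the coefficients are computed by the recurrence relation $$b_m^{(i,n-1)}=0,\qquad b_k^{(i,n-1)}=\frac{t_{n-1}-t_i}{t_n-t_i}\,b_{k+1}^{(i,n-1)}+\frac{t_n-t_{n-1}}{t_n-t_{i+1}}\,b_{k+1}^{(i+1,n-1)}\quad(k=m-1,m-2,\dots,0);$$ their explicit forms are $b_m^{(i,n-1)}=0$ and $$b_k^{(i,n-1)}=\frac{t_n-t_{n-1}}{t_n-t_{i+1}}\sum_{\ell=0}^{m-k-1}\Big(\frac{t_{n-1}-t_i}{t_n-t_i}\Big)^{\ell}b_{k+1+\ell}^{(i+1,n-1)}\quad(k=0,1,\dots,m-1).$$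 3. For $j=n-2,n-3,\dots,0$ and $i=j-1,j-2,\dots,j-m+1$ the coefficients are computed by the recurrence relation $$b_m^{(i,j)}=b_0^{(i,j+1)},$$ $$b_k^{(i,j)}=\frac{t_j-t_i}{t_{j+1}-t_i}\,b_{k+1}^{(i,j)}+\frac{v_i}{t_{j+1}-t_i}\Big((t_{j+1}-t_{m+i+2})\,b_k^{(i+1,j)}+(t_{m+i+2}-t_j)\,b_{k+1}^{(i+1,j)}\Big)\quad(k=m-1,m-2,\dots,0),$$ where $v_i:=\dfrac{t_{m+i+1}-t_i}{t_{m+i+2}-t_{i+1}}$; their explicit forms are $$b_k^{(i,j)}=\Big(\frac{t_j-t_i}{t_{j+1}-t_i}\Big)^{m-k}b_0^{(i,j+1)}+\sum_{\ell=0}^{m-k-1}\Big(\frac{t_j-t_i}{t_{j+1}-t_i}\Big)^{\ell}\frac{v_i}{t_{j+1}-t_i}\,q_{k+\ell},$$ where $q_\ell:=(t_{j+1}-t_{m+i+2})\,b_\ell^{(i+1,j)}+(t_{m+i+2}-t_j)\,b_{\ell+1}^{(i+1,j)}$.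
   Context: B-spline functions: for knots $t_i\le t_{i+1}\le\dots\le t_{i+m+1}$, the B-spline (basis) function of degree $m$ is $N_{mi}(u)=(t_{i+m+1}-t_i)\,[t_i,t_{i+1},\dots,t_{i+m+1}](t-u)_+^m$, where the generalized (confluent) divided difference acts on the variable $t$, and $(x-c)_+^m=(x-c)^m$ if $x\ge c$ and $0$ if $x<c$. On $[t_0,t_n)$ the functions are given (with values at the knots taken right-continuously) by the de Boor–Mansfield–Cox recursion: for $i=0,\dots,n-1$, $N_{0i}(u)=1$ if $u\in[t_i,t_{i+1})$ and $N_{0i}(u)=0$ otherwise, and for $p\ge1$, $-p\le i<n$, $$N_{pi}(u)=(u-t_i)\frac{N_{p-1,i}(u)}{t_{p+i}-t_i}+(t_{p+i+1}-u)\frac{N_{p-1,i+1}(u)}{t_{p+i+1}-t_{i+1}},$$ with the conventions that any quotient with zero denominator is $0$ and that $N_{pi}\equiv0$ for $i<-p$ or $i\ge n$. Bernstein polynomials: $B_k^m(t)=\binom{m}{k}t^k(1-t)^{m-k}$, $0\le k\le m$. Adjusted Bernstein–Bézier coefficients: on the knot span $[t_j,t_{j+1})$ $(0\le j\le n-1)$ each $N_{mi}$ is a polynomial of degree at most $m$, and the numbers $b_k^{(i,j)}$ $(0\le k\le m)$ are defined by $$N_{mi}(u)=\sum_{k=0}^m b_k^{(i,j)}B_k^m\Big(\frac{u-t_j}{t_{j+1}-t_j}\Big)\qquad(t_j\le u<t_{j+1}).$$ Computational complexity counts real arithmetic operations, the input being $n$, $m$ and the knots. Empty products equal $1$, empty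 sums equal $0$, and $0^0=1$. *)

theory Defs
  imports "HOL-Analysis.Analysis"
begin

section \<open>B-spline functions\<close>

text \<open>
  Generalized divided difference of \<open>f\<close> at the \<open>k + 1\<close> nodes \<open>x i, x (i + 1), \<dots>, x (i + k)\<close>.
  The nodes are assumed nondecreasing, so \<open>x (i + k) = x i\<close> means that all of them coincide,
  and the divided difference is then a Taylor coefficient.
\<close>

fun divided_diff :: "(real \<Rightarrow> real) \<Rightarrow> (int \<Rightarrow> real) \<Rightarrow> int \<Rightarrow> nat \<Rightarrow> real" where
  "divided_diff f x i 0 = f (x i)"
| "divided_diff f x i (Suc k) =
     (if x (i + int (Suc k)) = x i then (deriv ^^ Suc k) f (x i) / fact (Suc k)
      else (divided_diff f x (i + 1) k - divided_diff f x i k) / (x (i + int (Suc k)) - x i))"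

text \<open>\<open>trunc_power m c x\<close> is \<open>(x - c)\<^sub>+\<^sup>m\<close>; for \<open>m = 0\<close> it is the step function with value 1 at \<open>c\<close>.\<close>

definition trunc_power :: "nat \<Rightarrow> real \<Rightarrow> real \<Rightarrow> real" where
  "trunc_power m c x = (if x \<ge> c then (x - c) ^ m else 0)"

definition bspline_dd :: "(int \<Rightarrow> real) \<Rightarrow> nat \<Rightarrow> int \<Rightarrow> real \<Rightarrow> real" where
  "bspline_dd t m i u =
     (t (i + int m + 1) - t i) * divided_diff (\<lambda>x. trunc_power m u x) t i (m + 1)"

text \<open>
  If \<open>u\<close> is itself a knot, \<open>bspline_dd\<close> may involve derivatives of a truncated power at its
  break point, which need not exist. The values at the knots are therefore taken
  right-continuously. Away from the knots nothing changes (\<open>bspline_eq_bspline_dd\<close> below), and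
  the resulting functions satisfy the de Boor--Mansfield--Cox recursion everywhere
  (\<open>bspline_0\<close> and \<open>bspline_Suc\<close>).
\<close>

definition bspline :: "(int \<Rightarrow> real) \<Rightarrow> nat \<Rightarrow> int \<Rightarrow> real \<Rightarrow> real" where
  "bspline t m i u = Lim (at_right u) (bspline_dd t m i)"

definition clamped_knots :: "nat \<Rightarrow> nat \<Rightarrow> (int \<Rightarrow> real) \<Rightarrow> bool" where
  "clamped_knots m n t \<longleftrightarrow>
     (\<forall>l\<in>{- int m..0}. t l = t 0) \<and>
     (\<forall>l\<in>{0..<int n}. t l < t (l + 1)) \<and>
     (\<forall>l\<in>{int n..int n + int m}. t l = t (int n))"

text \<open>
  \<open>bb_coeff t m i j k\<close> is \<open>b\<^sub>k\<close> with upper index \<open>(i, j)\<close>. Only \<open>k \<le> m\<close> is meaningful;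
  the value 0 for \<open>k > m\<close> makes the coefficient function unique (see \<open>bb_coeff\<close> below).
\<close>

definition bb_coeff :: "(int \<Rightarrow> real) \<Rightarrow> nat \<Rightarrow> int \<Rightarrow> int \<Rightarrow> nat \<Rightarrow> real" where
  "bb_coeff t m i j = (THE b. (\<forall>k>m. b k = 0) \<and>
     (\<forall>u\<in>{t j..<t (j + 1)}. bspline t m i u =
        (\<Sum>k\<le>m. b k * Bernstein m k ((u - t j) / (t (j + 1) - t j)))))"


section \<open>Straight-line programs over the reals\<close>

text \<open>
  The input of a program are the knots in the registers \<open>Knot\<close>; all other registers are
  undefined at the start. Reading an undefined register or dividing by zero makes the execution
  fail (\<open>None\<close>). The cost of a program is the number of its arithmetic operations.
\<close>

datatype reg = Knot int | Coef int int nat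

datatype expr =
    Const int
  | Reg reg
  | Add expr expr
  | Sub expr expr
  | Mul expr expr
  | Div expr expr

type_synonym program = "(reg \<times> expr) list"
type_synonym state = "reg \<Rightarrow> real option"

fun eval_expr :: "state \<Rightarrow> expr \<Rightarrow> real option" where
  "eval_expr s (Const c) = Some (of_int c)"
| "eval_expr s (Reg r) = s r"
| "eval_expr s (Add a b) =
     Option.bind (eval_expr s a) (\<lambda>x. Option.bind (eval_expr s b) (\<lambda>y. Some (x + y)))"
| "eval_expr s (Sub a b) =
     Option.bind (eval_expr s a) (\<lambda>x. Option.bind (eval_expr s b) (\<lambda>y. Some (x - y)))"
| "eval_expr s (Mul a b) =
     Option.bind (eval_expr s a) (\<lambda>x. Option.bind (eval_expr s b) (\<lambda>y. Some (x * y)))"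
| "eval_expr s (Div a b) =
     Option.bind (eval_expr s a) (\<lambda>x. Option.bind (eval_expr s b)
       (\<lambda>y. if y = 0 then None else Some (x / y)))"

fun execute :: "program \<Rightarrow> state \<Rightarrow> state option" where
  "execute [] s = Some s"
| "execute ((r, e) # p) s = Option.bind (eval_expr s e) (\<lambda>x. execute p (s(r \<mapsto> x)))"

fun expr_ops :: "expr \<Rightarrow> nat" where
  "expr_ops (Const c) = 0"
| "expr_ops (Reg r) = 0"
| "expr_ops (Add a b) = expr_ops a + expr_ops b + 1"
| "expr_ops (Sub a b) = expr_ops a + expr_ops b + 1"
| "expr_ops (Mul a b) = expr_ops a + expr_ops b + 1"
| "expr_ops (Div a b) = expr_ops a + expr_ops b + 1"

definition program_ops :: "program \<Rightarrow> nat" where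
  "program_ops p = (\<Sum>(r, e)\<leftarrow>p. expr_ops e)"

fun knot_state :: "nat \<Rightarrow> nat \<Rightarrow> (int \<Rightarrow> real) \<Rightarrow> state" where
  "knot_state m n t (Knot l) = (if l \<in> {- int m..int n + int m} then Some (t l) else None)"
| "knot_state m n t (Coef i j k) = None"


section \<open>The algorithm for the adjusted Bernstein--Bezier coefficients\<close>

definition knot_diff :: "int \<Rightarrow> int \<Rightarrow> expr" where
  "knot_diff a b = Sub (Reg (Knot a)) (Reg (Knot b))"

definition prod_expr :: "expr list \<Rightarrow> expr" where
  "prod_expr es = foldr Mul es (Const 1)"

definition bb_step1 :: "nat \<Rightarrow> int \<Rightarrow> program" where
  "bb_step1 m j =
     [(Coef j j k, Const 0). k \<leftarrow> [0..<m]] @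
     [(Coef j j m,
       Div (prod_expr (replicate (m - 1) (knot_diff (j + 1) j)))
           (prod_expr [knot_diff (j + int k) j. k \<leftarrow> [2..<m + 1]])),
      (Coef (j - int m) j 0,
       Div (prod_expr (replicate (m - 1) (knot_diff (j + 1) j)))
           (prod_expr [knot_diff (j + 1) (j + 1 - int k). k \<leftarrow> [2..<m + 1]]))] @
     [(Coef (j - int m) j k, Const 0). k \<leftarrow> [1..<m + 1]]"

definition bb_step2 :: "nat \<Rightarrow> int \<Rightarrow> int \<Rightarrow> program" where
  "bb_step2 m n i =
     (Coef i (n - 1) m, Const 0) #
     [(Coef i (n - 1) k,
       Add (Mul (Div (knot_diff (n - 1) i) (knot_diff n i)) (Reg (Coef i (n - 1) (k + 1))))
           (Mul (Div (knot_diff n (n - 1)) (knot_diff n (i + 1)))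
                (Reg (Coef (i + 1) (n - 1) (k + 1))))).
      k \<leftarrow> rev [0..<m]]"

definition bb_step3 :: "nat \<Rightarrow> int \<Rightarrow> int \<Rightarrow> program" where
  "bb_step3 m j i =
     (let v = Div (knot_diff (int m + i + 1) i) (knot_diff (int m + i + 2) (i + 1)) in
      (Coef i j m, Reg (Coef i (j + 1) 0)) #
      [(Coef i j k,
        Add (Mul (Div (knot_diff j i) (knot_diff (j + 1) i)) (Reg (Coef i j (k + 1))))
            (Mul (Div v (knot_diff (j + 1) i))
                 (Add (Mul (knot_diff (j + 1) (int m + i + 2)) (Reg (Coef (i + 1) j k)))
                      (Mul (knot_diff (int m + i + 2) j) (Reg (Coef (i + 1) j (k + 1))))))).
       k \<leftarrow> rev [0..<m]])"

definition bb_program :: "nat \<Rightarrow> nat \<Rightarrow> program" where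
  "bb_program m n =
     concat [bb_step1 m j. j \<leftarrow> [0..int n - 1]] @
     concat [bb_step2 m (int n) i. i \<leftarrow> rev [int n - int m..int n - 2]] @
     concat [bb_step3 m j i. j \<leftarrow> rev [0..int n - 2], i \<leftarrow> rev [j - int m + 1..j - 1]]"


section \<open>The B-spline recursion\<close>

lemma higher_deriv_trunc_power:
  assumes "x \<noteq> c"
  shows "(deriv ^^ k) (\<lambda>x. trunc_power m c x) x =
    (if c < x \<and> k \<le> m then fact m / fact (m - k) * (x - c) ^ (m - k) else 0)"
  using assms
proof (induction k arbitrary: x)
  case 0
  then show ?case by (auto simp: trunc_power_def)
next
  case (Suc k)
  let ?f = "(deriv ^^ k) (\<lambda>x. trunc_power m c x)"
  show ?case
  proof (cases "c < x")
    case True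
    have "eventually (\<lambda>y. c < y) (nhds x)"
      using True by (rule order_tendstoD(1)[OF filterlim_ident])
    then have "eventually (\<lambda>y. ?f y = (if k \<le> m then fact m / fact (m - k) * (y - c) ^ (m - k) else 0)) (nhds x)"
      by eventually_elim (use Suc.IH in auto)
    then have "deriv ?f x = deriv (\<lambda>y. if k \<le> m then fact m / fact (m - k) * (y - c) ^ (m - k) else 0) x"
      by (rule deriv_cong_ev) simp
    also have "\<dots> = (if Suc k \<le> m then fact m / fact (m - Suc k) * (x - c) ^ (m - Suc k) else 0)"
    proof (cases "Suc k \<le> m")
      case le: True
      then obtain d where d: "m = k + Suc d" by (metis add_Suc_shift le_iff_add add_Suc_right add_Suc)
      have "((\<lambda>y. (y - c) ^ Suc d) has_field_derivative real (Suc d) * (x - c) ^ d) (at x)"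
        by (auto intro!: derivative_eq_intros simp del: power_Suc)
      from DERIV_cmult[OF this, of "fact m / fact (Suc d)"]
      have "((\<lambda>y. fact m / fact (Suc d) * (y - c) ^ Suc d) has_field_derivative
             fact m / fact d * (x - c) ^ d) (at x)"
        by (simp add: field_simps del: of_nat_Suc power_Suc)
      then show ?thesis using le d by (auto intro!: DERIV_imp_deriv simp del: power_Suc)
    next
      case False
      then consider "k = m" | "k > m" by linarith
      then show ?thesis by cases auto
    qed
    finally show ?thesis using True by simp
  next
    case False
    then have "x < c" using Suc.prems by simp
    then have "eventually (\<lambda>y. y < c) (nhds x)"
      by (rule order_tendstoD(2)[OF filterlim_ident])
    then have "eventually (\<lambda>y. ?f y = 0) (nhds x)"
      by eventually_elim (use Suc.IH in auto)
    then have "deriv ?f x = deriv (\<lambda>y. 0) x"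
      by (rule deriv_cong_ev) simp
    then show ?thesis using False by simp
  qed
qed

lemma higher_deriv_trunc_power_Suc:
  assumes ne: "x \<noteq> c"
  shows "(deriv ^^ Suc k) (\<lambda>x. trunc_power (Suc m) c x) x / fact (Suc k) =
    (x - c) * ((deriv ^^ Suc k) (\<lambda>x. trunc_power m c x) x / fact (Suc k))
    + (deriv ^^ k) (\<lambda>x. trunc_power m c x) x / fact k"
proof (cases "Suc k \<le> m")
  case le: True
  then obtain d where d: "m = Suc (k + d)" by (metis le_iff_add add_Suc)
  have e: "Suc m - Suc k = Suc d" "m - Suc k = d" "m - k = Suc d" using d by auto
  have alg: "((a + b) * M) / (a * D) * (z * y) / (b * K) = y * (M / D * z / (b * K)) + M / (a * D) * (z * y) / K"
    if "a > 0" "b > 0" "D > 0" "K > 0" for a b D K M y z :: real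
    using that by (simp add: field_simps)
  have f: "fact (Suc m) = ((real d + 1) + (real k + 1)) * fact m" "fact (Suc d) = (real d + 1) * fact d"
    "fact (Suc k) = (real k + 1) * fact k"
    using d by (simp_all only: fact_Suc) (simp_all add: algebra_simps)
  show ?thesis unfolding higher_deriv_trunc_power[OF ne] e f power_Suc2
    using le alg[of "real d + 1" "real k + 1" "fact d" "fact k" "fact m" "(x - c) ^ d" "x - c"]
    by (simp del: fact_Suc)
next
  case nle: False
  show ?thesis unfolding higher_deriv_trunc_power[OF ne] using nle
    by (cases "k = m") (auto simp: divide_simps simp del: of_nat_Suc)
qed

lemma divided_diff_eq_nodes:
  "x (i + int k) = x i \<Longrightarrow> divided_diff f x i k = (deriv ^^ k) f (x i) / fact k"
  by (cases k) auto

lemma divided_diff_step: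
  assumes "mono_on {i..i + int (Suc k)} x"
  shows "(x (i + int (Suc k)) - x i) * divided_diff f x i (Suc k)
    = divided_diff f x (i + 1) k - divided_diff f x i k"
proof (cases "x (i + int (Suc k)) = x i")
  case True
  have "x (i + int k) = x i" "x (i + 1) = x i"
    using mono_onD[OF assms, of i "i + int k"] mono_onD[OF assms, of "i + int k" "i + int (Suc k)"]
      mono_onD[OF assms, of i "i + 1"] mono_onD[OF assms, of "i + 1" "i + int (Suc k)"] True
    by auto
  moreover from this have "x (i + 1 + int k) = x (i + 1)"
    using True by (simp add: algebra_simps)
  ultimately show ?thesis using True by (simp add: divided_diff_eq_nodes del: divided_diff.simps)
next
  case False
  then show ?thesis by simp
qed

lemma divided_diff_trunc_power:
  assumes "mono_on {i..i + int (Suc k)} x" "\<And>l. l \<in> {i..i + int (Suc k)} \<Longrightarrow> x l \<noteq> c"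
  shows "divided_diff (\<lambda>x. trunc_power (Suc m) c x) x i (Suc k) =
    (x i - c) * divided_diff (\<lambda>x. trunc_power m c x) x i (Suc k)
    + divided_diff (\<lambda>x. trunc_power m c x) x (i + 1) k"
  using assms
proof (induction k arbitrary: i)
  case 0
  show ?case
  proof (cases "x (i + 1) = x i")
    case True
    have ne: "x i \<noteq> c" using 0(2)[of i] by simp
    show ?thesis using True higher_deriv_trunc_power_Suc[OF ne, of 0 m] by simp
  next
    case False
    then show ?thesis using 0(2)[of i] 0(2)[of "i + 1"]
      by (auto simp: trunc_power_def divide_simps) (auto simp: algebra_simps)
  qed
next
  case (Suc k)
  let ?g = "\<lambda>x. trunc_power m c x" and ?h = "\<lambda>x. trunc_power (Suc m) c x"
  let ?K = "Suc (Suc k)"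
  show ?case
  proof (cases "x (i + int ?K) = x i")
    case True
    have ne: "x i \<noteq> c" using Suc.prems(2)[of i] by simp
    have 1: "x (i + 1) = x i"
      using mono_onD[OF Suc.prems(1), of i "i + 1"] mono_onD[OF Suc.prems(1), of "i + 1" "i + int ?K"] True
      by auto
    then have 2: "x (i + 1 + int (Suc k)) = x (i + 1)"
      using True by (simp add: algebra_simps)
    note higher_deriv_trunc_power_Suc[OF ne, of "Suc k" m]
    then show ?thesis
      using divided_diff_eq_nodes[OF True] divided_diff_eq_nodes[OF 2] 1
      by (simp del: divided_diff.simps funpow.simps)
  next
    case False
    have mono: "mono_on {i..i + int (Suc k)} x" "mono_on {i + 1..i + 1 + int (Suc k)} x"
      using Suc.prems(1) by (auto elim!: mono_on_subset)
    have step: "(x (i + int ?K) - x i) * divided_diff f x i ?K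
        = divided_diff f x (i + 1) (Suc k) - divided_diff f x i (Suc k)" for f
      using divided_diff_step[OF Suc.prems(1)] .
    have eqi: "i + 1 + int (Suc k) = i + int ?K" by simp
    have step': "(x (i + int ?K) - x (i + 1)) * divided_diff ?g x (i + 1) (Suc k)
        = divided_diff ?g x (i + 1 + 1) k - divided_diff ?g x (i + 1) k"
      using divided_diff_step[OF mono(2), of ?g] unfolding eqi .
    have IH1: "divided_diff ?h x i (Suc k) = (x i - c) * divided_diff ?g x i (Suc k) + divided_diff ?g x (i + 1) k"
      by (rule Suc.IH[OF mono(1)]) (rule Suc.prems(2), auto)
    have IH2: "divided_diff ?h x (i + 1) (Suc k) = (x (i + 1) - c) * divided_diff ?g x (i + 1) (Suc k)
        + divided_diff ?g x (i + 1 + 1) k"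
      by (rule Suc.IH[OF mono(2)]) (rule Suc.prems(2), auto)
    have "(x (i + int ?K) - x i) * divided_diff ?h x i ?K =
      (x (i + int ?K) - x i) * ((x i - c) * divided_diff ?g x i ?K + divided_diff ?g x (i + 1) (Suc k))"
      using step[of ?h] step[of ?g] step' unfolding IH1 IH2 by algebra
    then show ?thesis using False by (simp del: divided_diff.simps)
  qed
qed

lemma divided_diff_trunc_power_top:
  assumes "x (i + int (Suc m)) = x i" "x i \<noteq> c"
  shows "divided_diff (\<lambda>x. trunc_power m c x) x i (Suc m) = 0"
  unfolding divided_diff_eq_nodes[where k = "Suc m", OF assms(1)] higher_deriv_trunc_power[OF assms(2)] by simp

lemma bspline_dd_Suc:
  assumes "mono_on {i..i + int m + 2} t" "\<And>l. l \<in> {i..i + int m + 2} \<Longrightarrow> t l \<noteq> u"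
  shows "bspline_dd t (Suc m) i u =
    (u - t i) * bspline_dd t m i u / (t (i + int m + 1) - t i) +
    (t (i + int m + 2) - u) * bspline_dd t m (i + 1) u / (t (i + int m + 2) - t (i + 1))"
proof -
  let ?g = "\<lambda>x. trunc_power m u x" and ?h = "\<lambda>x. trunc_power (Suc m) u x"
  have eqs: "i + int (Suc (Suc m)) = i + int m + 2" "i + int (Suc m) = i + int m + 1"
    "i + 1 + int (Suc m) = i + int m + 2" "i + int (Suc m) + 1 = i + int m + 2"
    "i + 1 + int m + 1 = i + int m + 2" "i + int m + 1 + 1 = i + int m + 2" by auto
  have mono: "mono_on {i..i + int (Suc m)} t" "mono_on {i + 1..i + 1 + int (Suc m)} t"
    "mono_on {i..i + int (Suc (Suc m))} t"
    using assms(1) by (auto elim!: mono_on_subset)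
  have L1: "divided_diff ?h t i (Suc m) = (t i - u) * divided_diff ?g t i (Suc m) + divided_diff ?g t (i + 1) m"
    by (rule divided_diff_trunc_power[OF mono(1)]) (rule assms(2), auto)
  have L2: "divided_diff ?h t (i + 1) (Suc m) = (t (i + 1) - u) * divided_diff ?g t (i + 1) (Suc m)
      + divided_diff ?g t (i + 1 + 1) m"
    by (rule divided_diff_trunc_power[OF mono(2)]) (rule assms(2), auto)
  have S1: "(t (i + int m + 2) - t i) * divided_diff ?h t i (Suc (Suc m)) =
      divided_diff ?h t (i + 1) (Suc m) - divided_diff ?h t i (Suc m)"
    using divided_diff_step[OF mono(3)] unfolding eqs .
  have S2: "(t (i + int m + 2) - t (i + 1)) * divided_diff ?g t (i + 1) (Suc m) =
      divided_diff ?g t (i + 1 + 1) m - divided_diff ?g t (i + 1) m"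
    using divided_diff_step[OF mono(2)] unfolding eqs .
  have "bspline_dd t (Suc m) i u = (u - t i) * divided_diff ?g t i (Suc m)
      + (t (i + int m + 2) - u) * divided_diff ?g t (i + 1) (Suc m)"
    unfolding bspline_dd_def Suc_eq_plus1[symmetric] eqs
    using S1 S2 unfolding L1 L2 eqs by algebra
  moreover have "bspline_dd t m i u / (t (i + int m + 1) - t i) = divided_diff ?g t i (Suc m)"
    using divided_diff_trunc_power_top[of t i m u] assms(2)[of i]
    by (cases "t (i + int m + 1) = t i") (auto simp: bspline_dd_def eqs simp del: divided_diff.simps of_nat_Suc)
  moreover have "bspline_dd t m (i + 1) u / (t (i + int m + 2) - t (i + 1)) = divided_diff ?g t (i + 1) (Suc m)"
    using divided_diff_trunc_power_top[of t "i + 1" m u] assms(2)[of "i + 1"]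
    by (cases "t (i + int m + 2) = t (i + 1)") (auto simp: bspline_dd_def eqs simp del: divided_diff.simps of_nat_Suc)
  ultimately show ?thesis by (metis times_divide_eq_right)
qed


lemma bspline_dd_0:
  assumes "t i \<le> t (i + 1)" "t i \<noteq> u" "t (i + 1) \<noteq> u"
  shows "bspline_dd t 0 i u = (if t i < u \<and> u < t (i + 1) then 1 else 0)"
  using assms by (auto simp: bspline_dd_def trunc_power_def)

primrec bspline_rec :: "(int \<Rightarrow> real) \<Rightarrow> nat \<Rightarrow> int \<Rightarrow> real \<Rightarrow> real" where
  "bspline_rec t 0 i u = (if t i \<le> u \<and> u < t (i + 1) then 1 else 0)"
| "bspline_rec t (Suc m) i u =
    (u - t i) * bspline_rec t m i u / (t (i + int m + 1) - t i) +
    (t (i + int m + 2) - u) * bspline_rec t m (i + 1) u / (t (i + int m + 2) - t (i + 1))"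

lemma bspline_dd_eq_rec:
  assumes "mono_on {i..i + int m + 1} t" "\<And>l. l \<in> {i..i + int m + 1} \<Longrightarrow> t l \<noteq> u"
  shows "bspline_dd t m i u = bspline_rec t m i u"
  using assms
proof (induction m arbitrary: i)
  case 0
  then show ?case using 0(2)[of i] 0(2)[of "i + 1"] mono_onD[OF 0(1), of i "i + 1"]
    by (subst bspline_dd_0) auto
next
  case (Suc m)
  have eqs: "i + int (Suc m) + 1 = i + int m + 2" "i + 1 + int m + 1 = i + int m + 2" by auto
  have "bspline_dd t m i u = bspline_rec t m i u"
    by (rule Suc.IH) (use Suc.prems in \<open>auto elim!: mono_on_subset\<close>)
  moreover have "bspline_dd t m (i + 1) u = bspline_rec t m (i + 1) u"
    by (rule Suc.IH) (use Suc.prems in \<open>auto elim!: mono_on_subset\<close>)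
  moreover note bspline_dd_Suc[of i m t u] Suc.prems
  ultimately show ?case unfolding eqs by simp
qed

lemma tendsto_bspline_rec: "(bspline_rec t m i \<longlongrightarrow> bspline_rec t m i u) (at_right u)"
proof (induction m arbitrary: i)
  case 0
  have "eventually (\<lambda>v. (t l \<le> v) = (t l \<le> u)) (at_right u)" for l
  proof (cases "t l \<le> u")
    case True
    then show ?thesis by (auto simp: eventually_at_right_field intro!: exI[of _ "u + 1"])
  next
    case False
    then show ?thesis by (auto simp: eventually_at_right_field intro!: exI[of _ "t l"])
  qed
  from this[of i] this[of "i + 1"]
  have "eventually (\<lambda>v. bspline_rec t 0 i v = bspline_rec t 0 i u) (at_right u)"
    by eventually_elim (auto simp: not_le[symmetric])
  then show ?case by (rule tendsto_eventually)
next
  case (Suc m)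
  show ?case unfolding bspline_rec.simps divide_inverse by (intro tendsto_intros Suc.IH)
qed

lemma bspline_eq_rec:
  assumes "mono_on {i..i + int m + 1} t"
  shows "bspline t m i u = bspline_rec t m i u"
proof -
  have "eventually (\<lambda>v. \<forall>l\<in>{i..i + int m + 1}. v \<noteq> t l) (at_right u)"
    by (intro eventually_ball_finite ballI) (auto intro: eventually_neq_at_within)
  then have "eventually (\<lambda>v. bspline_rec t m i v = bspline_dd t m i v) (at_right u)"
    by eventually_elim (subst bspline_dd_eq_rec[OF assms], auto)
  from Lim_transform_eventually[OF tendsto_bspline_rec this] show ?thesis
    unfolding bspline_def by (intro tendsto_Lim) auto
qed

lemma bspline_eq_bspline_dd:
  assumes "mono_on {i..i + int m + 1} t" "\<And>l. l \<in> {i..i + int m + 1} \<Longrightarrow> t l \<noteq> u"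
  shows "bspline t m i u = bspline_dd t m i u"
  using bspline_eq_rec[OF assms(1)] bspline_dd_eq_rec[OF assms] by simp

lemma bspline_0:
  assumes "t i \<le> t (i + 1)"
  shows "bspline t 0 i u = (if t i \<le> u \<and> u < t (i + 1) then 1 else 0)"
proof -
  have "mono_on {i..i + int 0 + 1} t"
  proof (rule mono_onI)
    fix r s assume "r \<in> {i..i + int 0 + 1}" "s \<in> {i..i + int 0 + 1}" "r \<le> s"
    then have "(r = i \<or> r = i + 1) \<and> (s = i \<or> s = i + 1) \<and> r \<le> s" by auto
    then show "t r \<le> t s" using assms by auto
  qed
  then show ?thesis by (subst bspline_eq_rec) auto
qed

lemma bspline_Suc:
  assumes "mono_on {i..i + int m + 2} t"
  shows "bspline t (Suc m) i u =
    (u - t i) * bspline t m i u / (t (i + int m + 1) - t i) +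
    (t (i + int m + 2) - u) * bspline t m (i + 1) u / (t (i + int m + 2) - t (i + 1))"
proof -
  have "mono_on {i..i + int (Suc m) + 1} t" "mono_on {i..i + int m + 1} t"
    "mono_on {i + 1..i + 1 + int m + 1} t"
    using assms by (auto elim!: mono_on_subset)
  then show ?thesis by (simp add: bspline_eq_rec)
qed


section \<open>Well-definedness of the coefficients\<close>

lemma Bernstein_unique:
  assumes "\<And>s. 0 \<le> s \<Longrightarrow> s < 1 \<Longrightarrow> (\<Sum>k\<le>m. b k * Bernstein m k s) = (\<Sum>k\<le>m. c k * Bernstein m k s)"
    and "k \<le> m"
  shows "b k = c k"
proof -
  let ?d = "\<lambda>k. (b k - c k) * real (m choose k)"
  have zero: "(\<Sum>k\<le>m. ?d k * x ^ k) = 0" if "x > 0" for x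
  proof -
    define s where "s = x / (1 + x)"
    have s: "0 \<le> s" "s < 1" "1 - s = 1 / (1 + x)" using that by (auto simp: s_def field_simps)
    have "Bernstein m k s = real (m choose k) * x ^ k / (1 + x) ^ m" if "k \<le> m" for k
    proof -
      have "(1 + x) ^ m = (1 + x) ^ k * (1 + x) ^ (m - k)" using that by (simp flip: power_add)
      then show ?thesis unfolding Bernstein_def s(3) unfolding s_def by (simp add: power_divide)
    qed
    then have "(\<Sum>k\<le>m. ?d k * x ^ k) / (1 + x) ^ m = (\<Sum>k\<le>m. (b k - c k) * Bernstein m k s)"
      unfolding sum_divide_distrib by (intro sum.cong) auto
    also have "\<dots> = 0" using assms(1)[OF s(1,2)] by (simp add: left_diff_distrib sum_subtractf)
    finally show ?thesis using that by auto
  qed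
  have "\<not> finite {x. (\<Sum>k\<le>m. ?d k * x ^ k) = 0}"
    using zero infinite_Ioi[of "0::real"] by (metis (mono_tags, lifting) finite_subset greaterThan_iff mem_Collect_eq subsetI)
  then have "\<forall>k\<le>m. ?d k = 0"
    using polyfun_finite_roots[of ?d m] by blast
  then show ?thesis using assms(2) by auto
qed

lemma linear_times_Bernstein:
  "\<exists>c. \<forall>s. (p * (1 - s) + q * s) * (\<Sum>k\<le>m. b k * Bernstein m k s) = (\<Sum>k\<le>Suc m. c k * Bernstein (Suc m) k s)"
proof -
  have 1: "(1 - s) * Bernstein m k s = real (Suc m - k) / real (Suc m) * Bernstein (Suc m) k s" if "k \<le> m" for k s
  proof -
    have "real (Suc m - k) * real (Suc m choose k) = real (Suc m) * real (m choose k)"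
      using binomial_absorb_comp[of "Suc m" k] by (metis diff_Suc_1 of_nat_mult)
    then have C: "real (m choose k) = real (Suc m - k) / real (Suc m) * real (Suc m choose k)"
      by (simp add: field_simps del: of_nat_Suc)
    have e: "(1 - s) ^ (Suc m - k) = (1 - s) * (1 - s) ^ (m - k)" using that by (simp add: Suc_diff_le)
    show ?thesis unfolding Bernstein_def e C by (simp only: mult_ac)
  qed
  have 2: "s * Bernstein m k s = real (Suc k) / real (Suc m) * Bernstein (Suc m) (Suc k) s" for k s
  proof -
    have "real (Suc k) * real (Suc m choose Suc k) = real (Suc m) * real (m choose k)"
      using Suc_times_binomial_eq[of m k] by (metis mult.commute of_nat_mult)
    then have C: "real (m choose k) = real (Suc k) / real (Suc m) * real (Suc m choose Suc k)"
      by (simp add: field_simps del: of_nat_Suc binomial_Suc_Suc)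
    show ?thesis unfolding Bernstein_def C power_Suc diff_Suc_Suc by (simp only: mult_ac)
  qed
  define c where "c k = (if k \<le> m then p * b k * real (Suc m - k) / real (Suc m) else 0)
     + (case k of 0 \<Rightarrow> 0 | Suc l \<Rightarrow> q * b l * real (Suc l) / real (Suc m))" for k
  have "(p * (1 - s) + q * s) * (\<Sum>k\<le>m. b k * Bernstein m k s) = (\<Sum>k\<le>Suc m. c k * Bernstein (Suc m) k s)" for s
  proof -
    have lin: "(p * (1 - s) + q * s) * (y * z) = p * y * ((1 - s) * z) + q * y * (s * z)" for y z
      by (simp add: algebra_simps)
    have "(p * (1 - s) + q * s) * (\<Sum>k\<le>m. b k * Bernstein m k s)
       = (\<Sum>k\<le>m. p * b k * ((1 - s) * Bernstein m k s)) + (\<Sum>k\<le>m. q * b k * (s * Bernstein m k s))"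
      unfolding sum_distrib_left sum.distrib[symmetric] by (intro sum.cong refl lin)
    also have "(\<Sum>k\<le>m. p * b k * ((1 - s) * Bernstein m k s))
       = (\<Sum>k\<le>Suc m. (if k \<le> m then p * b k * real (Suc m - k) / real (Suc m) else 0) * Bernstein (Suc m) k s)"
    proof -
      have "(\<Sum>k\<le>m. p * b k * ((1 - s) * Bernstein m k s)) = (\<Sum>k\<le>m.
        (if k \<le> m then p * b k * real (Suc m - k) / real (Suc m) else 0) * Bernstein (Suc m) k s)"
      proof (rule sum.cong[OF refl])
        fix k assume "k \<in> {..m}"
        then have k: "k \<le> m" by simp
        show "p * b k * ((1 - s) * Bernstein m k s)
          = (if k \<le> m then p * b k * real (Suc m - k) / real (Suc m) else 0) * Bernstein (Suc m) k s"
          unfolding 1[OF k] if_P[OF k] times_divide_eq_left times_divide_eq_right by (simp only: mult_ac)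
      qed
      then show ?thesis unfolding sum.atMost_Suc[of _ m] by simp
    qed
    also have "(\<Sum>k\<le>m. q * b k * (s * Bernstein m k s))
       = (\<Sum>k\<le>Suc m. (case k of 0 \<Rightarrow> 0 | Suc l \<Rightarrow> q * b l * real (Suc l) / real (Suc m)) * Bernstein (Suc m) k s)"
      unfolding sum.atMost_Suc_shift 2 by (simp add: mult.assoc del: of_nat_Suc)
    finally show ?thesis unfolding c_def distrib_right sum.distrib .
  qed
  then show ?thesis by blast
qed

lemma bspline_rec_Bernstein:
  assumes "t j < t (j + 1)" "mono_on {l0..l1} t" "l0 \<le> j" "j < l1"
    and "l0 \<le> i" "i + int m + 1 \<le> l1"
  shows "\<exists>b. \<forall>u\<in>{t j..<t (j + 1)}. bspline_rec t m i u =
    (\<Sum>k\<le>m. b k * Bernstein m k ((u - t j) / (t (j + 1) - t j)))"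
  using assms(5,6)
proof (induction m arbitrary: i)
  case 0
  have "bspline_rec t 0 i u = (if i = j then 1 else 0)" if u: "u \<in> {t j..<t (j + 1)}" for u
  proof (cases i j rule: linorder_cases)
    case less
    then have "t (i + 1) \<le> t j" using 0 assms(3,4) by (intro mono_onD[OF assms(2)]) auto
    then show ?thesis using less u by simp
  next
    case greater
    then have "t (j + 1) \<le> t i" using 0 assms(3,4) by (intro mono_onD[OF assms(2)]) auto
    then show ?thesis using greater u by simp
  qed (use u in auto)
  then show ?case
    by (intro exI[of _ "\<lambda>k. if i = j then 1 else 0"] ballI) (simp add: Bernstein_def del: bspline_rec.simps)
next
  case (Suc m)
  let ?s = "\<lambda>u. (u - t j) / (t (j + 1) - t j)"
  obtain b1 where b1: "\<forall>u\<in>{t j..<t (j + 1)}. bspline_rec t m i u = (\<Sum>k\<le>m. b1 k * Bernstein m k (?s u))"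
    by (rule exE[OF Suc.IH[of i]]) (use Suc.prems in linarith, use Suc.prems in linarith)
  obtain b2 where b2: "\<forall>u\<in>{t j..<t (j + 1)}. bspline_rec t m (i + 1) u = (\<Sum>k\<le>m. b2 k * Bernstein m k (?s u))"
    by (rule exE[OF Suc.IH[of "i + 1"]]) (use Suc.prems in linarith, use Suc.prems in linarith)
  let ?d1 = "t (i + int m + 1) - t i" and ?d2 = "t (i + int m + 2) - t (i + 1)"
  obtain c1 where c1: "\<forall>s. ((t j - t i) * (1 - s) + (t (j + 1) - t i) * s) * (\<Sum>k\<le>m. b1 k * Bernstein m k s)
      = (\<Sum>k\<le>Suc m. c1 k * Bernstein (Suc m) k s)"
    using linear_times_Bernstein[where p = "t j - t i" and q = "t (j + 1) - t i" and m = m and b = b1]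
    by (elim exE)
  obtain c2 where c2: "\<forall>s. ((t (i + int m + 2) - t j) * (1 - s) + (t (i + int m + 2) - t (j + 1)) * s)
      * (\<Sum>k\<le>m. b2 k * Bernstein m k s) = (\<Sum>k\<le>Suc m. c2 k * Bernstein (Suc m) k s)"
    using linear_times_Bernstein[where p = "t (i + int m + 2) - t j" and q = "t (i + int m + 2) - t (j + 1)"
        and m = m and b = b2]
    by (elim exE)
  have sum_comb: "(\<Sum>k\<in>A. f k * B k) / a + (\<Sum>k\<in>A. g k * B k) / b = (\<Sum>k\<in>A. (f k / a + g k / b) * B k)"
    for A :: "nat set" and f g B :: "nat \<Rightarrow> real" and a b
    by (simp add: sum_divide_distrib distrib_right flip: sum.distrib)
  have "bspline_rec t (Suc m) i u = (\<Sum>k\<le>Suc m. (c1 k / ?d1 + c2 k / ?d2) * Bernstein (Suc m) k (?s u))"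
    if u: "u \<in> {t j..<t (j + 1)}" for u
  proof -
    have lin: "(a - c) * (1 - s) + (b - c) * s = v - c" "(c - a) * (1 - s) + (c - b) * s = c - v"
      if "s * (b - a) = v - a" for a b c s v :: real
    proof -
      have v: "v = s * (b - a) + a" using that by simp
      show "(a - c) * (1 - s) + (b - c) * s = v - c" "(c - a) * (1 - s) + (c - b) * s = c - v"
        unfolding v by (simp_all add: algebra_simps)
    qed
    have h: "?s u * (t (j + 1) - t j) = u - t j" using assms(1) by simp
    have 1: "(t j - t i) * (1 - ?s u) + (t (j + 1) - t i) * ?s u = u - t i"
      by (rule lin(1)[OF h])
    have 2: "(t (i + int m + 2) - t j) * (1 - ?s u) + (t (i + int m + 2) - t (j + 1)) * ?s u = t (i + int m + 2) - u"
      by (rule lin(2)[OF h])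
    have e1: "(u - t i) * bspline_rec t m i u = (\<Sum>k\<le>Suc m. c1 k * Bernstein (Suc m) k (?s u))"
      using c1[rule_format, of "?s u"] unfolding 1 b1[rule_format, OF u] .
    have e2: "(t (i + int m + 2) - u) * bspline_rec t m (i + 1) u
        = (\<Sum>k\<le>Suc m. c2 k * Bernstein (Suc m) k (?s u))"
      using c2[rule_format, of "?s u"] unfolding 2 b2[rule_format, OF u] .
    show ?thesis
      unfolding bspline_rec.simps e1 e2
      by (rule sum_comb[where A = "{..Suc m}" and f = c1 and g = c2 and a = ?d1 and b = ?d2
            and B = "\<lambda>k. Bernstein (Suc m) k (?s u)"])
  qed
  then show ?case by (intro exI[of _ "\<lambda>k. c1 k / ?d1 + c2 k / ?d2"] ballI)
qed

lemma clamped_knots_mono: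
  assumes "clamped_knots m n t"
  shows "mono_on {- int m..int n + int m} t"
proof (rule mono_onI)
  have step: "t l \<le> t (l + 1)" if "l \<in> {- int m..<int n + int m}" for l
  proof -
    consider "l < 0" | "l \<in> {0..<int n}" | "l \<ge> int n" by force
    then show ?thesis
    proof cases
      case 1
      then have "l \<in> {- int m..0}" "l + 1 \<in> {- int m..0}" using that by auto
      then show ?thesis using assms unfolding clamped_knots_def by (metis order_refl)
    next
      case 2
      then show ?thesis using assms unfolding clamped_knots_def by (auto intro: less_imp_le)
    next
      case 3
      then have "l \<in> {int n..int n + int m}" "l + 1 \<in> {int n..int n + int m}" using that by auto
      then show ?thesis using assms unfolding clamped_knots_def by (metis order_refl)
    qed
  qed
  fix r s assume rs: "r \<in> {- int m..int n + int m}" "s \<in> {- int m..int n + int m}" "r \<le> s"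
  have "s \<le> int n + int m \<longrightarrow> t r \<le> t s"
    using rs(3)
  proof (induction rule: int_ge_induct)
    case (step l)
    then show ?case using \<open>\<And>l. l \<in> {- int m..<int n + int m} \<Longrightarrow> t l \<le> t (l + 1)\<close>[of l] rs(1) by auto
  qed simp
  then show "t r \<le> t s" using rs(2) by simp
qed

lemma bb_coeff:
  assumes "clamped_knots m n t" "0 \<le> j" "j < int n" "- int m \<le> i" "i < int n"
  shows "k > m \<Longrightarrow> bb_coeff t m i j k = 0"
    and "u \<in> {t j..<t (j + 1)} \<Longrightarrow> bspline t m i u =
      (\<Sum>k\<le>m. bb_coeff t m i j k * Bernstein m k ((u - t j) / (t (j + 1) - t j)))"
proof -
  let ?P = "\<lambda>b. (\<forall>k>m. b k = 0) \<and> (\<forall>u\<in>{t j..<t (j + 1)}. bspline t m i u =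
    (\<Sum>k\<le>m. b k * Bernstein m k ((u - t j) / (t (j + 1) - t j))))"
  have lt: "t j < t (j + 1)" using assms by (auto simp: clamped_knots_def)
  note mono = clamped_knots_mono[OF assms(1)]
  have eq: "bspline t m i = bspline_rec t m i"
    by (rule ext, rule bspline_eq_rec, rule mono_on_subset[OF mono]) (use assms in auto)
  obtain b where b: "\<forall>u\<in>{t j..<t (j + 1)}. bspline t m i u =
      (\<Sum>k\<le>m. b k * Bernstein m k ((u - t j) / (t (j + 1) - t j)))"
    unfolding eq by (rule exE[OF bspline_rec_Bernstein[OF lt mono, of i m]]) (use assms in linarith)+
  define b' where "b' k = (if k \<le> m then b k else 0)" for k
  have "(\<Sum>k\<le>m. b' k * B k) = (\<Sum>k\<le>m. b k * B k)" for B :: "nat \<Rightarrow> real"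
    by (intro sum.cong) (simp_all add: b'_def)
  with b have P: "?P b'" by (simp add: b'_def)
  have unique: "c = c'" if c: "?P c" and c': "?P c'" for c c'
  proof
    fix k
    have "(\<Sum>k\<le>m. c k * Bernstein m k s) = (\<Sum>k\<le>m. c' k * Bernstein m k s)" if "0 \<le> s" "s < 1" for s
    proof -
      define u where "u = t j + s * (t (j + 1) - t j)"
      have "s * (t (j + 1) - t j) < 1 * (t (j + 1) - t j)"
        by (rule mult_strict_right_mono) (use that lt in auto)
      moreover have "0 \<le> s * (t (j + 1) - t j)" using that lt by simp
      ultimately have u: "u \<in> {t j..<t (j + 1)}" unfolding u_def by auto
      have s: "(u - t j) / (t (j + 1) - t j) = s"
        using lt by (simp add: u_def)
      show ?thesis
        using bspec[OF conjunct2[OF c] u] bspec[OF conjunct2[OF c'] u] unfolding s by linarith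
    qed
    then show "c k = c' k"
      using Bernstein_unique[where m = m and b = c and c = c' and k = k] conjunct1[OF c] conjunct1[OF c']
      by (cases "k \<le> m") (blast, simp)
  qed
  have "?P (bb_coeff t m i j)"
    unfolding bb_coeff_def by (rule theI[where P = ?P, OF P unique[OF _ P]])
  note props = conjunct1[OF this] conjunct2[OF this]
  show "bb_coeff t m i j k = 0" if "k > m" using props(1) that by blast
  show "bspline t m i u = (\<Sum>k\<le>m. bb_coeff t m i j k * Bernstein m k ((u - t j) / (t (j + 1) - t j)))"
    if "u \<in> {t j..<t (j + 1)}"
    by (rule bspec[OF props(2) that])
qed

end

theory Submission
  imports Defs
begin

text \<open>
  On a fixed knot span \<open>[t j, t (j + 1))\<close> the coefficients obey a de Boor--Mansfield--Cox recursion
  of their own. Let \<open>a l k\<close> be the coefficients of the B-splines of degree \<open>m\<close>, divided by the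
  length of their support. Then the coefficients of degree \<open>m + 1\<close> are
  \<open>(t j - t i) * a i k + (t (i + m + 2) - t j) * a (i + 1) k\<close> at index \<open>k\<close>, and the same expression
  with \<open>t (j + 1)\<close> in place of \<open>t j\<close> at index \<open>k + 1\<close>: for \<open>0 < k \<le> m\<close> an index is reached in two
  ways, and the point of \<open>span_coeff_left\<close> is that both ways agree. (In terms of blossoms: an
  argument \<open>t j\<close> or \<open>t (j + 1)\<close> is peeled off, and the order of the arguments does not matter.)
  Given this, \<open>bspline_rec_span_coeff\<close> says that the numbers so defined are indeed the
  Bernstein--Bezier coefficients of the B-splines.

  The recursion in the degree is then turned into the recursion of the theorem, at constant degree.
  The coefficients with indices \<open>k\<close> and \<open>k + 1\<close> of the \<open>i\<close>-th B-spline \<open>N i\<close> of degree \<open>m + 1\<close>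
  are two linear combinations of \<open>a i k\<close> and \<open>a (i + 1) k\<close>; eliminating \<open>a i k\<close> leaves a multiple of \<open>a (i + 1) k\<close>. Doing the same for
  \<open>N (i + 1)\<close>, but eliminating \<open>a (i + 2) k\<close>, leaves a multiple of the same number
  \<open>a (i + 1) k\<close>. Equating the two gives the relation \<open>span_coeff_neighbour_relation\<close>. In the last
  span all knots to the right coincide, and the relation loses a term. The starting
  values come from the continuity of B-splines at simple knots, from their vanishing at the end
  of the support, and, for the two B-splines whose support ends or begins with the span, from a
  product formula. The explicit forms unroll a first-order linear recurrence.

  The program assigns to every register a value that is fixed in advance, namely the knot or
  coefficient that the register is named after. So its correctness is a question of order only:
  each assignment has to be justified by the formulas above from registers that are already
  filled. The number of operations is \<open>O(m)\<close> for each of the \<open>O(n m)\<close> pairs \<open>(i, j)\<close> that need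
  the recurrence, and \<open>O(m)\<close> for each \<open>j\<close> in the first step.
\<close>

section \<open>A recursion in the degree for the coefficients\<close>

text \<open>
  One step of the de Boor--Mansfield--Cox recursion. The degree, the family \<open>f\<close> of values of lower
  degree and the point \<open>x\<close> are separated, because the coefficients satisfy the recursion
  with a knot as the point.
\<close>

definition cox_step :: "(int \<Rightarrow> real) \<Rightarrow> nat \<Rightarrow> int \<Rightarrow> real \<Rightarrow> (int \<Rightarrow> real) \<Rightarrow> real" where
  "cox_step t m i x f =
    (x - t i) * (f i / (t (i + int m + 1) - t i)) +
    (t (i + int m + 2) - x) * (f (i + 1) / (t (i + int m + 2) - t (i + 1)))"

lemma bspline_rec_Suc:
  "bspline_rec t (Suc m) i u = cox_step t m i u (\<lambda>l. bspline_rec t m l u)"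
  by (simp add: cox_step_def)

text \<open>
  An index \<open>k > 0\<close> is always reduced with the right end \<open>t (j + 1)\<close>, although for \<open>k \<le> m\<close> the left
  end would do as well (\<open>span_coeff_left\<close>): the choice makes this an ordinary recursion in \<open>m\<close>.
\<close>

primrec span_coeff :: "(int \<Rightarrow> real) \<Rightarrow> int \<Rightarrow> nat \<Rightarrow> int \<Rightarrow> nat \<Rightarrow> real" where
  "span_coeff t j 0 i k = (if i = j then 1 else 0)"
| "span_coeff t j (Suc m) i k =
    (if k = 0 then cox_step t m i (t j) (\<lambda>l. span_coeff t j m l 0)
     else cox_step t m i (t (j + 1)) (\<lambda>l. span_coeff t j m l (k - 1)))"

lemma span_coeff_right:
  "span_coeff t j (Suc m) i (Suc k) = cox_step t m i (t (j + 1)) (\<lambda>l. span_coeff t j m l k)"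
  by simp

text \<open>
  Two steps of the recursion with the points \<open>x\<close> and \<open>y\<close> may be done in either order. The left and
  the right summands differ by \<open>(x - y) * a1\<close> with opposite signs; only this cancellation needs
  the denominators to be nonzero.
\<close>

lemma cox_step_exchange:
  fixes p q r s x y a0 a1 a2 :: real
  assumes "a1 \<noteq> 0 \<Longrightarrow> r \<noteq> p \<and> s \<noteq> q"
  shows "(x - p) * (((y - p) * a0 + (r - y) * a1) / (r - p))
       + (s - x) * (((y - q) * a1 + (s - y) * a2) / (s - q))
     = (y - p) * (((x - p) * a0 + (r - x) * a1) / (r - p))
       + (s - y) * (((x - q) * a1 + (s - x) * a2) / (s - q))"
proof (cases "a1 = 0")
  case True
  then show ?thesis by (simp add: mult.left_commute)
next
  case False
  then have "r - p \<noteq> 0" "s - q \<noteq> 0" using assms by auto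
  then show ?thesis by (simp add: divide_simps) (simp add: algebra_simps)
qed

text \<open>
  By induction the coefficients of degree \<open>m\<close> can themselves be written with either end of the span,
  so that the claim becomes the exchange of two steps, one with each end. Zero denominators are
  harmless: if one of the two outer denominators vanishes, monotonicity makes the
  denominator below \<open>a (i + 1)\<close> vanish too, so that \<open>a (i + 1) = 0\<close>.
\<close>

lemma span_coeff_left:
  assumes "mono_on {i..i + int m + 2} t" "k \<le> m"
  shows "span_coeff t j (Suc m) i k = cox_step t m i (t j) (\<lambda>l. span_coeff t j m l k)"
  using assms
proof (induction m arbitrary: i k)
  case 0
  then show ?case by simp
next
  case (Suc m)
  show ?case
  proof (cases k)
    case 0
    then show ?thesis by simp
  next
    case (Suc k')
    have k': "k' \<le> m" using Suc Suc.prems by simp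
    have left: "span_coeff t j (Suc m) l k' = cox_step t m l (t j) (\<lambda>l. span_coeff t j m l k')"
      if "l \<in> {i, i + 1}" for l
      by (rule Suc.IH[OF mono_on_subset[OF Suc.prems(1)] k']) (use that in auto)
    define a where "a l = span_coeff t j m l k' / (t (l + int m + 1) - t l)" for l
    have step: "cox_step t m l x (\<lambda>l. span_coeff t j m l k')
        = (x - t l) * a l + (t (l + int m + 2) - x) * a (l + 1)" for l x
      by (simp add: cox_step_def a_def add.commute add.left_commute)
    have nz: "t (i + int m + 2) \<noteq> t i \<and> t (i + 1 + int m + 2) \<noteq> t (i + 1)" if "a (i + 1) \<noteq> 0"
    proof -
      have "t (i + 1) \<noteq> t (i + int m + 2)"
        using that by (auto simp: a_def algebra_simps)
      moreover have "t i \<le> t (i + 1)" "t (i + 1) \<le> t (i + int m + 2)"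
        "t (i + int m + 2) \<le> t (i + 1 + int m + 2)"
        by (auto intro!: mono_onD[OF Suc.prems(1)])
      ultimately show ?thesis by linarith
    qed
    have eqs: "i + int (Suc m) + 1 = i + int m + 2" "i + int (Suc m) + 2 = i + 1 + int m + 2"
      by simp_all
    show ?thesis
      unfolding \<open>k = Suc k'\<close> span_coeff_right[of t j "Suc m"]
      unfolding cox_step_def[of t "Suc m"] span_coeff_right eqs left[OF insertI1]
        left[OF insertI2[OF singletonI]] step
      using nz by (rule cox_step_exchange)
  qed
qed

text \<open>
  Both sides are equal to \<open>(t (j + 1) - t j) * (t (i + m + 2) - t i) * (t (i + m + 3) - t (i + 1))\<close>
  times \<open>a (i + 1)\<close>, where \<open>a l\<close> is the coefficient of degree \<open>m\<close> divided by the length of the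
  support. In other words: the blossom of the B-spline \<open>i\<close> with one argument \<open>t i\<close> and that of the
  B-spline \<open>i + 1\<close> with one argument \<open>t (i + m + 3)\<close> are multiples of the same B-spline of degree
  \<open>m\<close>. The form without division holds for arbitrary multiplicities of the knots.
\<close>

lemma span_coeff_neighbour_relation:
  assumes "mono_on {i..i + int m + 2} t" "mono_on {i + 1..i + int m + 3} t" "k \<le> m"
  shows "((t (j + 1) - t i) * span_coeff t j (Suc m) i k
          - (t j - t i) * span_coeff t j (Suc m) i (Suc k)) * (t (i + int m + 3) - t (i + 1))
    = (t (i + int m + 2) - t i) *
      ((t (j + 1) - t (i + int m + 3)) * span_coeff t j (Suc m) (i + 1) k
          + (t (i + int m + 3) - t j) * span_coeff t j (Suc m) (i + 1) (Suc k))"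
proof -
  define a where "a l = span_coeff t j m l k / (t (l + int m + 1) - t l)" for l
  have step: "cox_step t m l x (\<lambda>l. span_coeff t j m l k)
      = (x - t l) * a l + (t (l + int m + 2) - x) * a (l + 1)" for l x
    by (simp add: cox_step_def a_def add.commute add.left_commute)
  have eq: "i + 1 + int m + 2 = i + int m + 3" by simp
  have l2: "span_coeff t j (Suc m) (i + 1) k = cox_step t m (i + 1) (t j) (\<lambda>l. span_coeff t j m l k)"
    by (rule span_coeff_left) (use assms in \<open>auto simp: eq\<close>)
  show ?thesis
    unfolding span_coeff_left[OF assms(1,3)] l2 span_coeff_right step eq by algebra
qed

section \<open>The recursion yields the Bernstein--Bezier coefficients\<close>

lemma Bernstein_Suc_left:
  assumes "k \<le> Suc m"
  shows "(1 - s) * Bernstein m k s = real (Suc m - k) / real (Suc m) * Bernstein (Suc m) k s"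
proof (cases "k \<le> m")
  case True
  have "real (Suc m - k) * real (Suc m choose k) = real (Suc m) * real (m choose k)"
    using binomial_absorb_comp[of "Suc m" k] by (metis diff_Suc_1 of_nat_mult)
  then have C: "real (m choose k) = real (Suc m - k) / real (Suc m) * real (Suc m choose k)"
    by (simp add: field_simps del: of_nat_Suc)
  have e: "(1 - s) ^ (Suc m - k) = (1 - s) * (1 - s) ^ (m - k)" using True by (simp add: Suc_diff_le)
  show ?thesis unfolding Bernstein_def e C by (simp only: mult_ac)
next
  case False
  then show ?thesis using assms by (simp add: Bernstein_def)
qed

lemma Bernstein_Suc_right:
  "s * Bernstein m k s = real (Suc k) / real (Suc m) * Bernstein (Suc m) (Suc k) s"
proof -
  have "real (Suc k) * real (Suc m choose Suc k) = real (Suc m) * real (m choose k)"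
    using Suc_times_binomial_eq[of m k] by (metis mult.commute of_nat_mult)
  then have C: "real (m choose k) = real (Suc k) / real (Suc m) * real (Suc m choose Suc k)"
    by (simp add: field_simps del: of_nat_Suc binomial_Suc_Suc)
  show ?thesis unfolding Bernstein_def C power_Suc diff_Suc_Suc by (simp only: mult_ac)
qed

text \<open>
  The factors \<open>1 - s\<close> and \<open>s\<close> turn \<open>Bernstein m k\<close> into the multiples \<open>(m + 1 - k) / (m + 1)\<close> of
  \<open>Bernstein (m + 1) k\<close> and \<open>(k + 1) / (m + 1)\<close> of \<open>Bernstein (m + 1) (k + 1)\<close>. So \<open>c k\<close> is collected
  with the weights \<open>(m + 1 - k) / (m + 1)\<close> and \<open>k / (m + 1)\<close>, whose sum is 1. At \<open>k = 0\<close> and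
  \<open>k = m + 1\<close> one of the weights vanishes, as it must, since only one of the assumptions applies.
\<close>

lemma Bernstein_elevate:
  assumes "\<And>k. k \<le> m \<Longrightarrow> c k = a k" "\<And>k. k \<le> m \<Longrightarrow> c (Suc k) = b k"
  shows "(1 - s) * (\<Sum>k\<le>m. a k * Bernstein m k s) + s * (\<Sum>k\<le>m. b k * Bernstein m k s)
    = (\<Sum>k\<le>Suc m. c k * Bernstein (Suc m) k s)"
proof -
  have "(1 - s) * (\<Sum>k\<le>m. a k * Bernstein m k s)
      = (\<Sum>k\<le>m. c k * (real (Suc m - k) / real (Suc m) * Bernstein (Suc m) k s))"
    unfolding sum_distrib_left
  proof (rule sum.cong[OF refl])
    fix k assume k: "k \<in> {..m}"
    then have "(1 - s) * (a k * Bernstein m k s) = c k * ((1 - s) * Bernstein m k s)"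
      using assms(1) by simp
    then show "(1 - s) * (a k * Bernstein m k s)
        = c k * (real (Suc m - k) / real (Suc m) * Bernstein (Suc m) k s)"
      using k by (subst (asm) Bernstein_Suc_left) simp_all
  qed
  moreover have "\<dots> = (\<Sum>k\<le>Suc m. c k * (real (Suc m - k) / real (Suc m) * Bernstein (Suc m) k s))"
    by simp
  moreover have "s * (\<Sum>k\<le>m. b k * Bernstein m k s)
      = (\<Sum>k\<le>m. c (Suc k) * (real (Suc k) / real (Suc m) * Bernstein (Suc m) (Suc k) s))"
    unfolding sum_distrib_left
  proof (rule sum.cong[OF refl])
    fix k assume "k \<in> {..m}"
    then have "s * (b k * Bernstein m k s) = c (Suc k) * (s * Bernstein m k s)"
      using assms(2) by simp
    then show "s * (b k * Bernstein m k s)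
        = c (Suc k) * (real (Suc k) / real (Suc m) * Bernstein (Suc m) (Suc k) s)"
      unfolding Bernstein_Suc_right .
  qed
  moreover have "\<dots> = (\<Sum>k\<le>Suc m. c k * (real k / real (Suc m) * Bernstein (Suc m) k s))"
    unfolding sum.atMost_Suc_shift by simp
  moreover have "c k * (real (Suc m - k) / real (Suc m) * B) + c k * (real k / real (Suc m) * B) = c k * B"
    if "k \<le> Suc m" for k and B :: real
  proof -
    have "real (Suc m - k) / real (Suc m) + real k / real (Suc m) = 1"
      using that by (simp add: of_nat_diff flip: add_divide_distrib)
    then show ?thesis by (metis distrib_left distrib_right mult_1)
  qed
  ultimately show ?thesis
    by (simp add: sum.distrib[symmetric] del: sum.atMost_Suc)
qed

lemma cox_step_Bernstein:
  "cox_step t m i u (\<lambda>l. \<Sum>k\<le>m. b l k * B k) = (\<Sum>k\<le>m. cox_step t m i u (\<lambda>l. b l k) * B k)"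
  unfolding cox_step_def
  by (simp only: sum_divide_distrib sum_distrib_left distrib_right sum.distrib[symmetric] times_divide_eq_left times_divide_eq_right mult.assoc)

lemma cox_step_affine:
  assumes "u = (1 - s) * x + s * y"
  shows "cox_step t m i u f = (1 - s) * cox_step t m i x f + s * cox_step t m i y f"
  unfolding cox_step_def assms by algebra

text \<open>
  A step of the recursion at \<open>u = (1 - s) * t j + s * t (j + 1)\<close> is the combination of the steps at
  \<open>t j\<close> and at \<open>t (j + 1)\<close> with the weights \<open>1 - s\<close> and \<open>s\<close>, and these two steps are the two
  descriptions of the coefficients of degree \<open>m + 1\<close>.
\<close>

lemma bspline_rec_span_coeff:
  assumes "mono_on {l0..l1} t" "l0 \<le> j" "j < l1" "l0 \<le> i" "i + int m + 1 \<le> l1"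
    and u: "u \<in> {t j..<t (j + 1)}"
  shows "bspline_rec t m i u =
    (\<Sum>k\<le>m. span_coeff t j m i k * Bernstein m k ((u - t j) / (t (j + 1) - t j)))"
  using assms(4,5)
proof (induction m arbitrary: i)
  case 0
  have "(t i \<le> u \<and> u < t (i + 1)) \<longleftrightarrow> i = j"
  proof (cases i j rule: linorder_cases)
    case less
    then have "t (i + 1) \<le> t j" using 0 assms(3) by (intro mono_onD[OF assms(1)]) auto
    then show ?thesis using less u by auto
  next
    case greater
    then have "t (j + 1) \<le> t i" using 0 assms(2) by (intro mono_onD[OF assms(1)]) auto
    then show ?thesis using greater u by auto
  qed (use u in auto)
  then show ?case by (simp add: Bernstein_def)
next
  case (Suc m)
  define s where "s = (u - t j) / (t (j + 1) - t j)"
  have "s * (t (j + 1) - t j) = u - t j" using u by (auto simp: s_def)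
  then have us: "u = (1 - s) * t j + s * t (j + 1)" by (simp add: algebra_simps)
  have mono: "mono_on {i..i + int m + 2} t"
    by (rule mono_on_subset[OF assms(1)]) (use Suc.prems in auto)
  have IH: "bspline_rec t m l u = (\<Sum>k\<le>m. span_coeff t j m l k * Bernstein m k s)" if "l \<in> {i, i + 1}" for l
    unfolding s_def by (rule Suc.IH) (use that Suc.prems in auto)
  have "bspline_rec t (Suc m) i u = cox_step t m i u (\<lambda>l. \<Sum>k\<le>m. span_coeff t j m l k * Bernstein m k s)"
    unfolding bspline_rec_Suc cox_step_def using IH by simp
  also have "\<dots> = (\<Sum>k\<le>Suc m. span_coeff t j (Suc m) i k * Bernstein (Suc m) k s)"
    unfolding cox_step_affine[OF us] unfolding cox_step_Bernstein
    by (rule Bernstein_elevate) (rule span_coeff_left[OF mono], assumption, rule span_coeff_right)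
  finally show ?case unfolding s_def .
qed

lemma bb_coeff_eq_span_coeff:
  assumes "clamped_knots m n t" "0 \<le> j" "j < int n" "- int m \<le> i" "i < int n" "k \<le> m"
  shows "bb_coeff t m i j k = span_coeff t j m i k"
proof (rule Bernstein_unique[OF _ assms(6)])
  fix s :: real assume s: "0 \<le> s" "s < 1"
  have lt: "t j < t (j + 1)" using assms by (auto simp: clamped_knots_def)
  note mono = clamped_knots_mono[OF assms(1)]
  define u where "u = t j + s * (t (j + 1) - t j)"
  have "s * (t (j + 1) - t j) < 1 * (t (j + 1) - t j)"
    by (rule mult_strict_right_mono) (use s lt in auto)
  moreover have "0 \<le> s * (t (j + 1) - t j)" using s lt by simp
  ultimately have u: "u \<in> {t j..<t (j + 1)}" unfolding u_def by auto
  have su: "(u - t j) / (t (j + 1) - t j) = s" using lt by (simp add: u_def)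
  have "bspline t m i u = bspline_rec t m i u"
    by (rule bspline_eq_rec, rule mono_on_subset[OF mono]) (use assms in auto)
  also have "\<dots> = (\<Sum>k\<le>m. span_coeff t j m i k * Bernstein m k s)"
    unfolding su[symmetric]
    by (rule bspline_rec_span_coeff[OF mono _ _ _ _ u]) (use assms in auto)
  finally show "(\<Sum>k\<le>m. bb_coeff t m i j k * Bernstein m k s) = (\<Sum>k\<le>m. span_coeff t j m i k * Bernstein m k s)"
    using bb_coeff(2)[OF assms(1-5) u] unfolding su by simp
qed

section \<open>Boundary values and continuity of the recursive coefficients\<close>

lemma span_coeff_outside:
  assumes "i > j \<or> i + int m < j"
  shows "span_coeff t j m i k = 0"
  using assms by (induction m arbitrary: i k) (auto simp: cox_step_def)

lemma span_coeff_last_support: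
  "k < m \<Longrightarrow> span_coeff t j m j k = 0"
proof (induction m arbitrary: k)
  case (Suc m)
  then show ?case by (cases k) (auto simp: cox_step_def span_coeff_outside)
qed simp

lemma span_coeff_first_support:
  "0 < k \<Longrightarrow> k \<le> m \<Longrightarrow> span_coeff t j m (j - int m) k = 0"
proof (induction m arbitrary: k)
  case (Suc m)
  have e: "j - int (Suc m) + 1 = j - int m" "j - int (Suc m) + int m + 2 = j + 1" by simp_all
  show ?case using Suc by (cases "k = 1") (auto simp: cox_step_def span_coeff_outside e simp del: of_nat_Suc)
qed simp

lemma span_coeff_last_top:
  "span_coeff t j m j m = (t (j + 1) - t j) ^ m / (\<Prod>k=1..m. t (j + int k) - t j)"
proof (induction m)
  case (Suc m)
  have e: "j + int (Suc m) = j + int m + 1" by simp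
  have "span_coeff t j (Suc m) j (Suc m)
      = (t (j + 1) - t j) * (span_coeff t j m j m / (t (j + int m + 1) - t j))"
    unfolding span_coeff_right cox_step_def by (simp add: span_coeff_outside)
  then show ?case unfolding Suc by (simp add: e del: of_nat_Suc span_coeff.simps)
qed simp

lemma span_coeff_first_bottom:
  "span_coeff t j m (j - int m) 0 = (t (j + 1) - t j) ^ m / (\<Prod>k=1..m. t (j + 1) - t (j + 1 - int k))"
proof (induction m)
  case (Suc m)
  have e: "j - int (Suc m) + 1 = j - int m" "j - int (Suc m) + int m + 2 = j + 1"
     "j + 1 - int (Suc m) = j - int m" by simp_all
  have "span_coeff t j (Suc m) (j - int (Suc m)) 0
      = (t (j + 1) - t j) * (span_coeff t j m (j - int m) 0 / (t (j + 1) - t (j - int m)))"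
    by (simp add: span_coeff_outside cox_step_def e del: of_nat_Suc)
  then show ?case unfolding Suc by (simp add: e del: of_nat_Suc span_coeff.simps)
qed simp

text \<open>
  This expresses that the B-spline of degree \<open>m\<close> is continuous at the simple knot \<open>t (j + 1)\<close>. Both
  sides are computed by the same steps with the point \<open>t (j + 1)\<close>, from neighbouring spans. The
  induction starts at degree 1: step functions are not continuous, but the first step multiplies
  their jumps at \<open>t (j + 1)\<close> by 0 or, for \<open>i = j\<close>, lets two jumps of opposite sign cancel.
\<close>

lemma span_coeff_continuous:
  assumes "t j < t (j + 1)" "t (j + 1) < t (j + 2)" "m > 0"
  shows "span_coeff t j m i m = span_coeff t (j + 1) m i 0"
  using assms(3)
proof (induction m arbitrary: i)
  case (Suc m)
  show ?case
  proof (cases "m = 0")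
    case True
    then show ?thesis using assms(1,2) by (auto simp: cox_step_def add.commute[of 2])
  next
    case False
    then show ?thesis using Suc by (simp add: cox_step_def)
  qed
qed simp

text \<open>
  The left limit at \<open>t (j + 1)\<close> of a B-spline vanishes if all knots of its support beyond the span
  coincide with \<open>t (j + 1)\<close>, except for the B-spline whose support begins with the span. In the step
  at the point \<open>t (j + 1)\<close> the first summand vanishes by induction; the second has the factor
  \<open>t (i + m + 2) - t (j + 1) = 0\<close>, unless the B-spline \<open>i + 1\<close> of lower degree ends before the span.
\<close>

lemma span_coeff_right_end:
  assumes "i < j" "\<And>l. j < l \<Longrightarrow> l \<le> i + int m + 1 \<Longrightarrow> t l = t (j + 1)"
  shows "span_coeff t j m i m = 0"
  using assms
proof (induction m arbitrary: i)
  case (Suc m)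
  have "span_coeff t j m i m = 0"
    by (rule Suc.IH[OF Suc.prems(1)], rule Suc.prems(2)) simp_all
  moreover have "span_coeff t j m (i + 1) m = 0 \<or> t (i + int m + 2) = t (j + 1)"
  proof (cases "i + 1 + int m < j")
    case False
    then have "j < i + int m + 2" "i + int m + 2 \<le> i + int (Suc m) + 1" by simp_all
    then show ?thesis by (rule disjI2[OF Suc.prems(2)])
  qed (simp add: span_coeff_outside)
  ultimately show ?case unfolding span_coeff_right cox_step_def
    by (elim disjE) simp_all
qed simp

section \<open>The relations between the coefficients\<close>

lemma linear_recurrence_unrolled:
  fixes b s :: "nat \<Rightarrow> 'a::comm_ring_1"
  assumes "\<And>k. k < m \<Longrightarrow> b k = r * b (k + 1) + s k" "k < m"
  shows "b k = r ^ (m - k) * b m + (\<Sum>l=0..m - k - 1. r ^ l * s (k + l))"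
proof -
  have "b k = r ^ d * b (k + d) + (\<Sum>l<d. r ^ l * s (k + l))" if "k + d \<le> m" for d
    using that
  proof (induction d)
    case (Suc d)
    then show ?case using assms(1)[of "k + d"] by (simp add: algebra_simps)
  qed simp
  from this[of "m - k"] have "b k = r ^ (m - k) * b m + (\<Sum>l<m - k. r ^ l * s (k + l))"
    using assms(2) by simp
  also have "{..<m - k} = {0..m - k - 1}" using assms(2) by auto
  finally show ?thesis .
qed

text \<open>
  The recursion yields a product over all \<open>k \<ge> 1\<close>, whose first factor is the length of the span
  and cancels against one of the \<open>m\<close> factors in the numerator.
\<close>

lemma power_div_prod_cancel:
  fixes f :: "nat \<Rightarrow> real"
  assumes "1 \<le> m" "f 1 = h" "h \<noteq> 0"
  shows "h ^ m / (\<Prod>k=1..m. f k) = h ^ (m - 1) / (\<Prod>k=2..m. f k)"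
proof -
  have "(\<Prod>k=1..m. f k) = h * (\<Prod>k=2..m. f k)"
    using assms by (subst prod.atLeast_Suc_atMost) (simp_all add: numeral_2_eq_2)
  moreover have "h ^ m = h * h ^ (m - 1)"
    using assms(1) by (simp add: power_eq_if)
  ultimately show ?thesis using assms(3) by simp
qed

context
  fixes m n :: nat and t :: "int \<Rightarrow> real"
  assumes m: "1 \<le> m" and n: "1 \<le> n" and clamped: "clamped_knots m n t"
begin

lemma knot_le:
  assumes "- int m \<le> i" "i \<le> j" "j \<le> int n + int m"
  shows "t i \<le> t j"
  by (rule mono_onD[OF clamped_knots_mono[OF clamped]]) (use assms in auto)

lemma knot_less:
  assumes "- int m \<le> i" "i \<le> j" "j < l" "l \<le> int n + int m" "0 \<le> j" "j < int n"
  shows "t i < t l"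
proof -
  have "t i \<le> t j" "t (j + 1) \<le> t l" by (rule knot_le; use assms in simp)+
  moreover have "t j < t (j + 1)" using clamped assms unfolding clamped_knots_def by simp
  ultimately show ?thesis by linarith
qed

lemma knot_right_end: "int n \<le> l \<Longrightarrow> l \<le> int n + int m \<Longrightarrow> t l = t (int n)"
  using clamped unfolding clamped_knots_def by (metis atLeastAtMost_iff)

lemma bb_coeff_last_support:
  assumes "0 \<le> j" "j < int n"
  shows "k < m \<Longrightarrow> bb_coeff t m j j k = 0"
    and "bb_coeff t m j j m = (t (j + 1) - t j) ^ (m - 1) / (\<Prod>k=2..m. t (j + int k) - t j)"
proof -
  note eq = bb_coeff_eq_span_coeff[OF clamped assms, of j]
  show "k < m \<Longrightarrow> bb_coeff t m j j k = 0"
    using eq[of k] assms by (simp add: span_coeff_last_support)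
  have "t j < t (j + 1)" by (rule knot_less) (use assms m in auto)
  then show "bb_coeff t m j j m = (t (j + 1) - t j) ^ (m - 1) / (\<Prod>k=2..m. t (j + int k) - t j)"
    using power_div_prod_cancel[OF m, of "\<lambda>k. t (j + int k) - t j" "t (j + 1) - t j"] eq[of m] assms
    unfolding span_coeff_last_top by simp
qed

lemma bb_coeff_first_support:
  assumes "0 \<le> j" "j < int n"
  shows "bb_coeff t m (j - int m) j 0
      = (t (j + 1) - t j) ^ (m - 1) / (\<Prod>k=2..m. t (j + 1) - t (j + 1 - int k))"
    and "1 \<le> k \<Longrightarrow> k \<le> m \<Longrightarrow> bb_coeff t m (j - int m) j k = 0"
proof -
  note eq = bb_coeff_eq_span_coeff[OF clamped assms, of "j - int m"]
  show "1 \<le> k \<Longrightarrow> k \<le> m \<Longrightarrow> bb_coeff t m (j - int m) j k = 0"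
    using eq[of k] assms by (simp add: span_coeff_first_support)
  have "t j < t (j + 1)" by (rule knot_less) (use assms m in auto)
  then show "bb_coeff t m (j - int m) j 0
      = (t (j + 1) - t j) ^ (m - 1) / (\<Prod>k=2..m. t (j + 1) - t (j + 1 - int k))"
    using power_div_prod_cancel[OF m, of "\<lambda>k. t (j + 1) - t (j + 1 - int k)" "t (j + 1) - t j"]
      eq[of 0] assms
    unfolding span_coeff_first_bottom by simp
qed

lemma bb_coeff_continuous:
  assumes "0 \<le> j" "j + 1 < int n" "- int m \<le> i" "i < int n"
  shows "bb_coeff t m i j m = bb_coeff t m i (j + 1) 0"
proof -
  have "span_coeff t j m i m = span_coeff t (j + 1) m i 0"
    using knot_less[of j j "j + 1"] knot_less[of "j + 1" "j + 1" "j + 2"] assms m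
    by (intro span_coeff_continuous) auto
  then show ?thesis
    using bb_coeff_eq_span_coeff[OF clamped, of j i m] bb_coeff_eq_span_coeff[OF clamped, of "j + 1" i 0] assms
    by simp
qed

lemma bb_coeff_right_end:
  assumes "- int m \<le> i" "i < int n - 1"
  shows "bb_coeff t m i (int n - 1) m = 0"
proof -
  have "span_coeff t (int n - 1) m i m = 0"
  proof (rule span_coeff_right_end)
    fix l assume "int n - 1 < l" "l \<le> i + int m + 1"
    then show "t l = t (int n - 1 + 1)" using knot_right_end[of l] assms by simp
  qed (use assms in simp)
  then show ?thesis
    using bb_coeff_eq_span_coeff[OF clamped, of "int n - 1" i m] assms n by simp
qed

lemma bb_coeff_recurrence:
  assumes j: "0 \<le> j" "j < int n" and i: "j - int m + 1 \<le> i" "i \<le> j - 1" and k: "k < m"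
  shows "bb_coeff t m i j k =
    (t j - t i) / (t (j + 1) - t i) * bb_coeff t m i j (k + 1)
    + (t (int m + i + 1) - t i) / (t (int m + i + 2) - t (i + 1)) / (t (j + 1) - t i) *
      ((t (j + 1) - t (int m + i + 2)) * bb_coeff t m (i + 1) j k
       + (t (int m + i + 2) - t j) * bb_coeff t m (i + 1) j (k + 1))"
proof -
  obtain m' where m': "m = Suc m'" using m by (cases m) auto
  have eqs: "int m + i + 1 = i + int m' + 2" "int m + i + 2 = i + int m' + 3" using m' by auto
  have pos: "0 < t (j + 1) - t i" "0 < t (int m + i + 2) - t (i + 1)"
    unfolding diff_gt_0_iff_gt by (rule knot_less[of _ j]; use assms in linarith)+
  have solve: "x = p / P * y + V / D / P * R"
    if "(P * x - p * y) * D = V * R" "0 < P" "0 < D" for x y p P V D R :: real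
  proof -
    have "P * x - p * y = V * R / D" using that(1,3) by (intro eq_divide_imp) simp_all
    then have "x * P = p * y + V / D * R" by (simp add: algebra_simps)
    then have "x = (p * y + V / D * R) / P" using that(2) by (intro eq_divide_imp) simp_all
    then show ?thesis by (simp add: add_divide_distrib)
  qed
  have mono: "mono_on {i..i + int m' + 2} t" "mono_on {i + 1..i + int m' + 3} t"
    by (rule mono_on_subset[OF clamped_knots_mono[OF clamped]]; use assms m' in auto)+
  have "k \<le> m'" using k m' by simp
  note relation = span_coeff_neighbour_relation[OF mono this, of j]
  have bb: "bb_coeff t m l j k' = span_coeff t j (Suc m') l k'"
    if "l \<in> {i, i + 1}" "k' \<le> m" for l k'
    unfolding m'[symmetric] by (rule bb_coeff_eq_span_coeff[OF clamped]) (use assms that in auto)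
  have "k \<le> m" "Suc k \<le> m" using k by simp_all
  note bbs = this[THEN bb[OF insertI1]] this[THEN bb[OF insertI2[OF singletonI]]]
  have "((t (j + 1) - t i) * bb_coeff t m i j k - (t j - t i) * bb_coeff t m i j (k + 1))
      * (t (int m + i + 2) - t (i + 1))
    = (t (int m + i + 1) - t i) *
      ((t (j + 1) - t (int m + i + 2)) * bb_coeff t m (i + 1) j k
       + (t (int m + i + 2) - t j) * bb_coeff t m (i + 1) j (k + 1))"
    unfolding eqs Suc_eq_plus1[symmetric] bbs by (rule relation)
  from solve[OF this pos] show ?thesis .
qed

text \<open>
  To the right of the last span all knots are equal to \<open>t n\<close>. Hence \<open>t (m + i + 2) = t (m + i + 1) = t n\<close>,
  the coefficient with index \<open>k\<close> of the neighbour gets the factor 0, and a factor \<open>t n - t i\<close> cancels.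
\<close>

lemma bb_coeff_last_span_recurrence:
  assumes i: "int n - int m \<le> i" "i \<le> int n - 2" and k: "k < m"
  shows "bb_coeff t m i (int n - 1) k =
    (t (int n - 1) - t i) / (t (int n) - t i) * bb_coeff t m i (int n - 1) (k + 1)
    + (t (int n) - t (int n - 1)) / (t (int n) - t (i + 1)) * bb_coeff t m (i + 1) (int n - 1) (k + 1)"
proof -
  have e: "t (int m + i + 1) = t (int n)" "t (int m + i + 2) = t (int n)"
    using assms by (auto intro!: knot_right_end)
  have "t i < t (int n)"
    by (rule knot_less[of _ "int n - 1"]) (use assms n in auto)
  then have cancel: "(t (int n) - t i) / y / (t (int n) - t i) * (x * z) = x / y * z" for x y z
    by simp
  have "bb_coeff t m i (int n - 1) k =
    (t (int n - 1) - t i) / (t (int n) - t i) * bb_coeff t m i (int n - 1) (k + 1)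
    + (t (int n) - t i) / (t (int n) - t (i + 1)) / (t (int n) - t i) *
      ((t (int n) - t (int n)) * bb_coeff t m (i + 1) (int n - 1) k
       + (t (int n) - t (int n - 1)) * bb_coeff t m (i + 1) (int n - 1) (k + 1))"
    using bb_coeff_recurrence[of "int n - 1" i k] assms n unfolding e diff_add_cancel by linarith
  then show ?thesis unfolding diff_self mult_zero_left add_0 cancel .
qed

lemma bb_coeff_last_span_explicit:
  assumes i: "int n - int m \<le> i" "i \<le> int n - 2" and k: "k < m"
  shows "bb_coeff t m i (int n - 1) k =
    (t (int n) - t (int n - 1)) / (t (int n) - t (i + 1)) *
    (\<Sum>l=0..m - k - 1. ((t (int n - 1) - t i) / (t (int n) - t i)) ^ l * bb_coeff t m (i + 1) (int n - 1) (k + 1 + l))"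
proof -
  have "bb_coeff t m i (int n - 1) m = 0"
    by (rule bb_coeff_right_end) (use i in auto)
  then show ?thesis
    using linear_recurrence_unrolled[of m "bb_coeff t m i (int n - 1)",
        OF bb_coeff_last_span_recurrence[OF i] k]
    by (simp add: sum_distrib_left mult_ac)
qed

lemma bb_coeff_explicit:
  assumes j: "0 \<le> j" "j \<le> int n - 2" and i: "j - int m + 1 \<le> i" "i \<le> j - 1" and k: "k < m"
  shows "bb_coeff t m i j k =
    ((t j - t i) / (t (j + 1) - t i)) ^ (m - k) * bb_coeff t m i (j + 1) 0
    + (\<Sum>l=0..m - k - 1. ((t j - t i) / (t (j + 1) - t i)) ^ l
         * ((t (int m + i + 1) - t i) / (t (int m + i + 2) - t (i + 1)) / (t (j + 1) - t i))
         * ((t (j + 1) - t (int m + i + 2)) * bb_coeff t m (i + 1) j (k + l)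
            + (t (int m + i + 2) - t j) * bb_coeff t m (i + 1) j (k + l + 1)))"
proof -
  have "bb_coeff t m i j m = bb_coeff t m i (j + 1) 0"
    by (rule bb_coeff_continuous) (use i j in auto)
  moreover have "j < int n" using j by simp
  ultimately show ?thesis
    using linear_recurrence_unrolled[of m "bb_coeff t m i j",
        OF bb_coeff_recurrence[OF j(1) \<open>j < int n\<close> i] k]
    by (simp only: mult.assoc)
qed

end

section \<open>Straight-line programs with prescribed register values\<close>

definition agrees :: "(reg \<Rightarrow> real) \<Rightarrow> reg set \<Rightarrow> state \<Rightarrow> bool" where
  "agrees val D s \<longleftrightarrow> (\<forall>r\<in>D. s r = Some (val r))"

text \<open>
  Correctness of a program relative to one fixed target value for every register. The registers that
  the program has assigned are added to those in \<open>D\<close>, so that specifications compose by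
  sequencing alone, and an assignment that repeats an earlier one does no harm.
\<close>

definition computes :: "(reg \<Rightarrow> real) \<Rightarrow> reg set \<Rightarrow> program \<Rightarrow> bool" where
  "computes val D p \<longleftrightarrow>
    (\<forall>s. agrees val D s \<longrightarrow> (\<exists>s'. execute p s = Some s' \<and> agrees val (D \<union> fst ` set p) s'))"

lemma agreesD: "agrees val D s \<Longrightarrow> r \<in> D \<Longrightarrow> s r = Some (val r)"
  by (simp add: agrees_def)

lemma agrees_subset: "agrees val D s \<Longrightarrow> D' \<subseteq> D \<Longrightarrow> agrees val D' s"
  by (auto simp: agrees_def)

lemma execute_append: "execute (p @ q) s = Option.bind (execute p s) (execute q)"
proof (induction p arbitrary: s)
  case (Cons x p)
  then show ?case by (cases x; cases "eval_expr s (snd x)") (simp_all add: fun_upd_def)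
qed simp

lemma execute_frame: "execute p s = Some s' \<Longrightarrow> r \<notin> fst ` set p \<Longrightarrow> s' r = s r"
  by (induction p s rule: execute.induct) (auto split: bind_splits)

lemma computes_Nil: "computes val D []"
  by (simp add: computes_def)

lemma computes_append:
  assumes "computes val D p" "computes val (D \<union> fst ` set p) q"
  shows "computes val D (p @ q)"
  using assms unfolding computes_def execute_append set_append image_Un
  by (metis Option.bind.bind_lunit Un_assoc)

lemma computes_mono:
  assumes "computes val D p" "D \<subseteq> D'"
  shows "computes val D' p"
  unfolding computes_def
proof (intro allI impI)
  fix s assume s: "agrees val D' s"
  with assms obtain s' where s': "execute p s = Some s'" "agrees val (D \<union> fst ` set p) s'"
    unfolding computes_def by (meson agrees_subset)
  then have "agrees val (D' \<union> fst ` set p) s'"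
    using s execute_frame[OF s'(1)] unfolding agrees_def by (metis Un_iff)
  then show "\<exists>s'. execute p s = Some s' \<and> agrees val (D' \<union> fst ` set p) s'"
    using s'(1) by blast
qed

lemma computes_single:
  assumes "\<And>s. agrees val D s \<Longrightarrow> eval_expr s e = Some (val r)"
  shows "computes val D [(r, e)]"
  unfolding computes_def using assms by (auto simp: agrees_def)

lemma computes_independent:
  assumes "\<And>r e s. (r, e) \<in> set p \<Longrightarrow> agrees val D s \<Longrightarrow> eval_expr s e = Some (val r)"
  shows "computes val D p"
  using assms
proof (induction p)
  case (Cons x p)
  obtain r e where x: "x = (r, e)" by force
  have "computes val D ([x] @ p)"
  proof (rule computes_append)
    show "computes val D [x]" unfolding x by (rule computes_single) (use Cons.prems x in auto)
    have "computes val D p" by (rule Cons.IH) (use Cons.prems in auto)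
    then show "computes val (D \<union> fst ` set [x]) p" by (rule computes_mono) auto
  qed
  then show ?case by simp
qed (simp add: computes_Nil)

lemma computes_concat_independent:
  assumes "\<And>p. p \<in> set ps \<Longrightarrow> computes val D p"
  shows "computes val D (concat ps)"
  using assms
proof (induction ps)
  case (Cons p ps)
  have "computes val D (concat ps)" by (rule Cons.IH) (use Cons.prems in auto)
  then have "computes val (D \<union> fst ` set p) (concat ps)" by (rule computes_mono) auto
  with Cons.prems show ?case by (auto intro!: computes_append)
qed (simp add: computes_Nil)

text \<open>
  The assignment with index \<open>k\<close> may use the results with larger indices; this is the order in which
  the recurrences run.
\<close>

lemma computes_downto:
  assumes "\<And>k s. k < m \<Longrightarrow> agrees val (D \<union> r ` {k + 1..<m}) s \<Longrightarrow> eval_expr s (e k) = Some (val (r k))"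
  shows "computes val D (map (\<lambda>k. (r k, e k)) (rev [0..<m]))"
  using assms
proof (induction m arbitrary: D)
  case (Suc m)
  have "computes val D ([(r m, e m)] @ map (\<lambda>k. (r k, e k)) (rev [0..<m]))"
  proof (rule computes_append)
    show "computes val D [(r m, e m)]" by (rule computes_single) (use Suc.prems[of m] in simp)
    show "computes val (D \<union> fst ` set [(r m, e m)]) (map (\<lambda>k. (r k, e k)) (rev [0..<m]))"
    proof (rule Suc.IH)
      fix k s assume "k < m" and s: "agrees val (D \<union> fst ` set [(r m, e m)] \<union> r ` {k + 1..<m}) s"
      moreover have "{k + 1..<Suc m} = insert m {k + 1..<m}" using \<open>k < m\<close> by auto
      ultimately show "eval_expr s (e k) = Some (val (r k))"
        by (intro Suc.prems) simp_all
    qed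
  qed
  then show ?case by simp
qed (simp add: computes_Nil)

lemma computes_concat_downto:
  fixes a b :: int
  assumes "\<And>x. a \<le> x \<Longrightarrow> x \<le> b \<Longrightarrow> computes val (D \<union> (\<Union>y\<in>{x + 1..b}. fst ` set (f y))) (f x)"
  shows "computes val D (concat (map f (rev [a..b])))"
  using assms
proof (induction "nat (b + 1 - a)" arbitrary: a)
  case 0
  then show ?case by (simp add: computes_Nil)
next
  case (Suc d)
  have "computes val D (concat (map f (rev [a + 1..b])) @ f a)"
  proof (rule computes_append)
    show "computes val D (concat (map f (rev [a + 1..b])))"
      by (rule Suc.hyps(1)) (use Suc.hyps(2) Suc.prems in auto)
    show "computes val (D \<union> fst ` set (concat (map f (rev [a + 1..b])))) (f a)"
      using Suc.prems[of a] Suc.hyps(2) by (simp add: image_UN)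
  qed
  moreover have "[a..b] = a # [a + 1..b]" using Suc.hyps(2) by (intro upto_rec1) auto
  ultimately show ?case by simp
qed

lemma eval_knot_diff:
  assumes "s (Knot a) = Some x" "s (Knot b) = Some y"
  shows "eval_expr s (knot_diff a b) = Some (x - y)"
  using assms by (simp add: knot_diff_def)

lemma eval_prod_expr:
  assumes "\<And>x. x \<in> set xs \<Longrightarrow> eval_expr s (e x) = Some (f x)"
  shows "eval_expr s (prod_expr (map e xs)) = Some (prod_list (map f xs))"
  using assms by (induction xs) (auto simp: prod_expr_def)

lemma eval_prod_expr_replicate:
  assumes "eval_expr s e = Some x"
  shows "eval_expr s (prod_expr (replicate k e)) = Some (x ^ k)"
  using assms by (induction k) (auto simp: prod_expr_def)

lemma eval_Div:
  assumes "eval_expr s a = Some x" "eval_expr s b = Some y" "y \<noteq> 0"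
  shows "eval_expr s (Div a b) = Some (x / y)"
  using assms by simp

section \<open>The number of arithmetic operations\<close>

lemma expr_ops_prod_expr: "expr_ops (prod_expr es) = (\<Sum>e\<leftarrow>es. expr_ops e) + length es"
  by (induction es) (auto simp: prod_expr_def)

lemma concat_concat_map: "concat (concat (map f xs)) = concat (map (\<lambda>x. concat (f x)) xs)"
  by (induction xs) simp_all

lemma program_ops_Nil: "program_ops [] = 0"
  by (simp add: program_ops_def)

lemma program_ops_append: "program_ops (p @ q) = program_ops p + program_ops q"
  by (simp add: program_ops_def)

lemma program_ops_Cons: "program_ops ((r, e) # p) = expr_ops e + program_ops p"
  by (simp add: program_ops_def)

lemma program_ops_map:
  assumes "\<And>x. x \<in> set xs \<Longrightarrow> expr_ops (e x) = c"
  shows "program_ops (map (\<lambda>x. (r x, e x)) xs) = c * length xs"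
  using assms by (induction xs) (auto simp: program_ops_def)

lemma program_ops_concat_le:
  assumes "\<And>x. x \<in> set xs \<Longrightarrow> program_ops (f x) \<le> c"
  shows "program_ops (concat (map f xs)) \<le> length xs * c"
  using assms
proof (induction xs)
  case Nil
  then show ?case by (simp add: program_ops_def)
next
  case (Cons x xs)
  have "program_ops (f x) \<le> c" "program_ops (concat (map f xs)) \<le> length xs * c"
    using Cons by auto
  then show ?case by (simp add: program_ops_append)
qed

lemma program_ops_bb_step1: "1 \<le> m \<Longrightarrow> program_ops (bb_step1 m j) \<le> 8 * m"
  unfolding bb_step1_def
  by (cases m) (auto simp: program_ops_append program_ops_Cons program_ops_Nil program_ops_map[where c = 0] expr_ops_prod_expr
      knot_diff_def sum_list_replicate sum_list_triv comp_def)

lemma program_ops_bb_step2: "program_ops (bb_step2 m n i) = 9 * m"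
  unfolding bb_step2_def by (simp add: program_ops_Cons program_ops_map[where c = 9] knot_diff_def)

lemma program_ops_bb_step3: "program_ops (bb_step3 m j i) = 16 * m"
  unfolding bb_step3_def Let_def by (simp add: program_ops_Cons program_ops_map[where c = 16] knot_diff_def)

text \<open>
  The three parts of the program cost at most \<open>n\<close> times \<open>8 m\<close>, \<open>m - 1\<close> times \<open>9 m\<close> and \<open>(n - 1) (m - 1)\<close>
  times \<open>16 m\<close> operations; each part is a constant multiple of at most \<open>n * m\<^sup>2\<close>, and \<open>8 + 9 + 16 = 33\<close>.
\<close>

lemma program_ops_bb_program:
  assumes "1 \<le> m" "1 \<le> n"
  shows "program_ops (bb_program m n) \<le> 33 * (n * m\<^sup>2)"
proof -
  have len: "nat (int k - 1) = k - 1" for k by (cases k) simp_all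
  have "program_ops (concat [bb_step1 m j. j \<leftarrow> [0..int n - 1]]) \<le> n * (8 * m)"
    using program_ops_concat_le[where xs = "[0..int n - 1]" and f = "bb_step1 m"] program_ops_bb_step1[OF assms(1)]
    by simp
  moreover have "program_ops (concat [bb_step2 m (int n) i. i \<leftarrow> rev [int n - int m..int n - 2]]) \<le> (m - 1) * (9 * m)"
    using program_ops_concat_le[where xs = "rev [int n - int m..int n - 2]" and f = "bb_step2 m (int n)" and c = "9 * m"]
    by (simp add: program_ops_bb_step2 len)
  moreover have "program_ops (concat [bb_step3 m j i. j \<leftarrow> rev [0..int n - 2], i \<leftarrow> rev [j - int m + 1..j - 1]])
     \<le> (n - 1) * ((m - 1) * (16 * m))"
  proof -
    have "program_ops (concat (map (bb_step3 m j) (rev [j - int m + 1..j - 1]))) \<le> (m - 1) * (16 * m)" for j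
      using program_ops_concat_le[where xs = "rev [j - int m + 1..j - 1]" and f = "bb_step3 m j" and c = "16 * m"]
      by (simp add: program_ops_bb_step3 len)
    from program_ops_concat_le[where xs = "rev [0..int n - 2]", OF this]
    have "program_ops (concat (map (\<lambda>j. concat (map (bb_step3 m j) (rev [j - int m + 1..j - 1]))) (rev [0..int n - 2])))
      \<le> (n - 1) * ((m - 1) * (16 * m))" by (simp add: len)
    then show ?thesis by (simp add: concat_concat_map)
  qed
  ultimately have "program_ops (bb_program m n)
      \<le> n * (8 * m) + (m - 1) * (9 * m) + (n - 1) * ((m - 1) * (16 * m))"
    unfolding bb_program_def program_ops_append by linarith
  also have "\<dots> \<le> n * (8 * (m * m)) + (n * m) * (9 * m) + n * (m * (16 * m))"
    using assms by (intro add_mono mult_mono) (auto intro: order_trans[of _ m])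
  also have "\<dots> = 33 * (n * m\<^sup>2)" by (simp add: power2_eq_square)
  finally show ?thesis .
qed

section \<open>The program computes the coefficients\<close>

definition knot_regs :: "nat \<Rightarrow> nat \<Rightarrow> reg set" where
  "knot_regs m n = Knot ` {- int m..int n + int m}"

definition coef_regs :: "nat \<Rightarrow> int \<Rightarrow> int \<Rightarrow> reg set" where
  "coef_regs m i j = Coef i j ` {0..m}"

definition bb_value :: "(int \<Rightarrow> real) \<Rightarrow> nat \<Rightarrow> reg \<Rightarrow> real" where
  "bb_value t m r = (case r of Knot l \<Rightarrow> t l | Coef i j k \<Rightarrow> bb_coeff t m i j k)"

lemma bb_value_simps [simp]:
  "bb_value t m (Knot l) = t l"
  "bb_value t m (Coef i j k) = bb_coeff t m i j k"
  by (simp_all add: bb_value_def)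

lemma targets_bb_step1: "fst ` set (bb_step1 m j) = coef_regs m j j \<union> coef_regs m (j - int m) j"
proof -
  have "coef_regs m j j = insert (Coef j j m) (Coef j j ` {0..<m})"
    unfolding coef_regs_def by (simp add: atLeastLessThanSuc_atLeastAtMost[symmetric] atLeast0_lessThan_Suc)
  moreover have "coef_regs m (j - int m) j = insert (Coef (j - int m) j 0) (Coef (j - int m) j ` {1..<m + 1})"
  proof -
    have "{0..m} = insert 0 {1..<m + 1}" by auto
    then show ?thesis by (simp add: coef_regs_def)
  qed
  ultimately show ?thesis by (auto simp: bb_step1_def image_image image_Un)
qed

lemma targets_bb_step2: "fst ` set (bb_step2 m n i) = coef_regs m i (n - 1)"
  unfolding coef_regs_def
  by (simp add: bb_step2_def image_image atLeastLessThanSuc_atLeastAtMost[symmetric] atLeast0_lessThan_Suc)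

lemma targets_bb_step3: "fst ` set (bb_step3 m j i) = coef_regs m i j"
  unfolding coef_regs_def
  by (simp add: bb_step3_def Let_def image_image atLeastLessThanSuc_atLeastAtMost[symmetric] atLeast0_lessThan_Suc)

context
  fixes m n :: nat and t :: "int \<Rightarrow> real"
  assumes m: "1 \<le> m" and n: "1 \<le> n" and clamped: "clamped_knots m n t"
begin

lemma eval_knot_diff_agrees:
  assumes "agrees (bb_value t m) D s" "knot_regs m n \<subseteq> D"
    and "- int m \<le> a" "a \<le> int n + int m" "- int m \<le> b" "b \<le> int n + int m"
  shows "eval_expr s (knot_diff a b) = Some (t a - t b)"
proof -
  have "s (Knot l) = Some (t l)" if "- int m \<le> l" "l \<le> int n + int m" for l
  proof -
    have "Knot l \<in> D" using assms(2) that by (auto simp: knot_regs_def)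
    from agreesD[OF assms(1) this] show ?thesis by simp
  qed
  with assms show ?thesis by (intro eval_knot_diff) auto
qed

text \<open>
  All assignments of this step depend on the knots only, so their order does not matter. The divisions
  succeed because every factor of a denominator is the distance of two knots with the span
  between them.
\<close>

lemma computes_bb_step1:
  assumes j: "0 \<le> j" "j < int n"
  shows "computes (bb_value t m) (knot_regs m n) (bb_step1 m j)"
proof (rule computes_independent)
  fix r e s assume re: "(r, e) \<in> set (bb_step1 m j)" and s: "agrees (bb_value t m) (knot_regs m n) s"
  note diff = eval_knot_diff_agrees[OF s order_refl]
  have prod_list: "prod_list (map f [2..<m + 1]) = (\<Prod>k=2..m. f k)" for f :: "nat \<Rightarrow> real"
  proof -
    have "set [2..<m + 1] = {2..m}" by auto
    then show ?thesis using prod.distinct_set_conv_list[of "[2..<m + 1]" f] by (metis distinct_upt)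
  qed
  have prod: "eval_expr s (prod_expr (map e [2..<m + 1])) = Some (\<Prod>k=2..m. f k)"
    if "\<And>k. 2 \<le> k \<Longrightarrow> k \<le> m \<Longrightarrow> eval_expr s (e k) = Some (f k)" for e f
  proof -
    have "eval_expr s (prod_expr (map e [2..<m + 1])) = Some (prod_list (map f [2..<m + 1]))"
      by (rule eval_prod_expr) (use that in auto)
    then show ?thesis unfolding prod_list .
  qed
  have power: "eval_expr s (prod_expr (replicate (m - 1) (knot_diff (j + 1) j)))
      = Some ((t (j + 1) - t j) ^ (m - 1))"
    by (rule eval_prod_expr_replicate[OF diff]) (use j in auto)
  consider (last_zero) k where "k < m" "r = Coef j j k" "e = Const 0"
    | (last_top) "r = Coef j j m" "e = Div (prod_expr (replicate (m - 1) (knot_diff (j + 1) j)))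
           (prod_expr (map (\<lambda>k. knot_diff (j + int k) j) [2..<m + 1]))"
    | (first_bottom) "r = Coef (j - int m) j 0" "e = Div (prod_expr (replicate (m - 1) (knot_diff (j + 1) j)))
           (prod_expr (map (\<lambda>k. knot_diff (j + 1) (j + 1 - int k)) [2..<m + 1]))"
    | (first_zero) k where "1 \<le> k" "k \<le> m" "r = Coef (j - int m) j k" "e = Const 0"
    using re unfolding bb_step1_def by auto
  then show "eval_expr s e = Some (bb_value t m r)"
  proof cases
    case last_zero
    then show ?thesis using bb_coeff_last_support[OF m n clamped j] by simp
  next
    case last_top
    have "t j < t (j + int k)" if "2 \<le> k" "k \<le> m" for k
      by (rule knot_less[OF m n clamped, of _ j]) (use j that in auto)
    then have "(\<Prod>k=2..m. t (j + int k) - t j) \<noteq> 0" by fastforce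
    moreover have "eval_expr s (prod_expr (map (\<lambda>k. knot_diff (j + int k) j) [2..<m + 1]))
        = Some (\<Prod>k=2..m. t (j + int k) - t j)"
      by (rule prod, rule diff) (use j in auto)
    ultimately show ?thesis
      unfolding last_top bb_value_simps bb_coeff_last_support(2)[OF m n clamped j] by (intro eval_Div power)
  next
    case first_bottom
    have "t (j + 1 - int k) < t (j + 1)" if "2 \<le> k" "k \<le> m" for k
      by (rule knot_less[OF m n clamped, of _ j]) (use j that in auto)
    then have "(\<Prod>k=2..m. t (j + 1) - t (j + 1 - int k)) \<noteq> 0" by fastforce
    moreover have "eval_expr s (prod_expr (map (\<lambda>k. knot_diff (j + 1) (j + 1 - int k)) [2..<m + 1]))
        = Some (\<Prod>k=2..m. t (j + 1) - t (j + 1 - int k))"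
      by (rule prod, rule diff) (use j in auto)
    ultimately show ?thesis
      unfolding first_bottom bb_value_simps bb_coeff_first_support(1)[OF m n clamped j] by (intro eval_Div power)
  next
    case first_zero
    then show ?thesis using bb_coeff_first_support[OF m n clamped j] by simp
  qed
qed

lemma computes_bb_step2:
  assumes i: "int n - int m \<le> i" "i \<le> int n - 2"
    and D: "knot_regs m n \<subseteq> D" "coef_regs m (i + 1) (int n - 1) \<subseteq> D"
  shows "computes (bb_value t m) D (bb_step2 m (int n) i)"
proof -
  let ?val = "bb_value t m"
  let ?r = "\<lambda>k. Coef i (int n - 1) k"
  let ?e = "\<lambda>k. Add (Mul (Div (knot_diff (int n - 1) i) (knot_diff (int n) i)) (Reg (Coef i (int n - 1) (k + 1))))
           (Mul (Div (knot_diff (int n) (int n - 1)) (knot_diff (int n) (i + 1)))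
                (Reg (Coef (i + 1) (int n - 1) (k + 1))))"
  have "computes ?val D [(?r m, Const 0)]"
    by (rule computes_single) (use bb_coeff_right_end[OF m n clamped, of i] i in simp)
  moreover have "computes ?val (D \<union> fst ` set [(?r m, Const 0)]) (map (\<lambda>k. (?r k, ?e k)) (rev [0..<m]))"
  proof (rule computes_downto)
    fix k s assume k: "k < m"
      and s: "agrees ?val (D \<union> fst ` set [(?r m, Const 0)] \<union> ?r ` {k + 1..<m}) s" (is "agrees _ ?D _")
    have "?r (k + 1) \<in> ?D" using k by (cases "k + 1 = m") auto
    moreover have "Coef (i + 1) (int n - 1) (k + 1) \<in> ?D" using D(2) k by (auto simp: coef_regs_def)
    moreover have "knot_regs m n \<subseteq> ?D" using D by auto
    moreover have "t i < t (int n)" "t (i + 1) < t (int n)"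
      by (rule knot_less[OF m n clamped, of _ "int n - 1"]; use i n in simp)+
    ultimately show "eval_expr s (?e k) = Some (?val (?r k))"
      unfolding bb_value_simps bb_coeff_last_span_recurrence[OF m n clamped i k]
      using i eval_knot_diff_agrees[OF s] agreesD[OF s] by simp
  qed
  ultimately have "computes ?val D ([(?r m, Const 0)] @ map (\<lambda>k. (?r k, ?e k)) (rev [0..<m]))"
    by (rule computes_append)
  then show ?thesis by (simp add: bb_step2_def)
qed

text \<open>
  The assignments need the column of \<open>i + 1\<close> in the same span, and one number from the span to the
  right, which is the starting value of the recurrence.
\<close>

lemma computes_bb_step3:
  assumes j: "0 \<le> j" "j \<le> int n - 2" and i: "j - int m + 1 \<le> i" "i \<le> j - 1"
    and D: "knot_regs m n \<subseteq> D" "coef_regs m (i + 1) j \<subseteq> D" "Coef i (j + 1) 0 \<in> D"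
  shows "computes (bb_value t m) D (bb_step3 m j i)"
proof -
  let ?val = "bb_value t m"
  let ?r = "\<lambda>k. Coef i j k"
  let ?v = "Div (knot_diff (int m + i + 1) i) (knot_diff (int m + i + 2) (i + 1))"
  let ?e = "\<lambda>k. Add (Mul (Div (knot_diff j i) (knot_diff (j + 1) i)) (Reg (Coef i j (k + 1))))
             (Mul (Div ?v (knot_diff (j + 1) i))
                 (Add (Mul (knot_diff (j + 1) (int m + i + 2)) (Reg (Coef (i + 1) j k)))
                      (Mul (knot_diff (int m + i + 2) j) (Reg (Coef (i + 1) j (k + 1))))))"
  have "computes ?val D [(?r m, Reg (Coef i (j + 1) 0))]"
    by (rule computes_single) (use bb_coeff_continuous[OF m n clamped, of j i] D(3) i j in \<open>simp add: agrees_def\<close>)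
  moreover have "computes ?val (D \<union> fst ` set [(?r m, Reg (Coef i (j + 1) 0))]) (map (\<lambda>k. (?r k, ?e k)) (rev [0..<m]))"
  proof (rule computes_downto)
    fix k s assume k: "k < m"
      and s: "agrees ?val (D \<union> fst ` set [(?r m, Reg (Coef i (j + 1) 0))] \<union> ?r ` {k + 1..<m}) s" (is "agrees _ ?D _")
    have "?r (k + 1) \<in> ?D" using k by (cases "k + 1 = m") auto
    moreover have "Coef (i + 1) j k \<in> ?D" "Coef (i + 1) j (k + 1) \<in> ?D" using D(2) k by (auto simp: coef_regs_def)
    moreover have "knot_regs m n \<subseteq> ?D" using D by auto
    moreover have "t i < t (j + 1)" "t (i + 1) < t (int m + i + 2)"
      by (rule knot_less[OF m n clamped, of _ j]; use i j in simp)+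
    moreover have "j < int n" using j by simp
    ultimately show "eval_expr s (?e k) = Some (?val (?r k))"
      unfolding bb_value_simps bb_coeff_recurrence[OF m n clamped j(1) \<open>j < int n\<close> i k]
      using i j eval_knot_diff_agrees[OF s] agreesD[OF s] by simp
  qed
  ultimately have "computes ?val D ([(?r m, Reg (Coef i (j + 1) 0))] @ map (\<lambda>k. (?r k, ?e k)) (rev [0..<m]))"
    by (rule computes_append)
  then show ?thesis by (simp add: bb_step3_def)
qed

text \<open>
  What remains is the order of the steps. In a fixed span, the column of \<open>i + 1\<close> comes from the first
  step if \<open>i + 1 = j\<close>, and otherwise was computed just before, since \<open>i\<close> decreases. The starting
  value for \<open>(i, j)\<close> belongs to \<open>(i, j + 1)\<close>, which is covered by the first step if
  \<open>i = j + 1 - m\<close>, by the second step if \<open>j + 1\<close> is the last span, and otherwise by an earlier round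
  of the third step, since \<open>j\<close> decreases. Every pair \<open>(i, j)\<close> with \<open>j - m \<le> i \<le> j\<close> is reached in one
  of these ways.
\<close>

lemma execute_bb_program:
  "\<exists>s. execute (bb_program m n) (knot_state m n t) = Some s \<and>
    (\<forall>j\<in>{0..int n - 1}. \<forall>i\<in>{j - int m..j}. \<forall>k\<in>{0..m}. s (Coef i j k) = Some (bb_coeff t m i j k))"
proof -
  let ?val = "bb_value t m" and ?K = "knot_regs m n"
  define row where "row j = concat (map (bb_step3 m j) (rev [j - int m + 1..j - 1]))" for j
  define P1 where "P1 = concat (map (bb_step1 m) [0..int n - 1])"
  define P2 where "P2 = concat (map (bb_step2 m (int n)) (rev [int n - int m..int n - 2]))"
  define P3 where "P3 = concat (map row (rev [0..int n - 2]))"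
  have program: "bb_program m n = P1 @ P2 @ P3"
    by (simp add: bb_program_def P1_def P2_def P3_def row_def[abs_def] concat_concat_map)
  have row: "fst ` set (row j) = (\<Union>i\<in>{j - int m + 1..j - 1}. coef_regs m i j)" for j
    by (simp add: row_def image_UN targets_bb_step3)
  have S1: "fst ` set P1 = (\<Union>j\<in>{0..int n - 1}. coef_regs m j j \<union> coef_regs m (j - int m) j)"
    by (simp add: P1_def image_UN targets_bb_step1)
  have S2: "fst ` set P2 = (\<Union>i\<in>{int n - int m..int n - 2}. coef_regs m i (int n - 1))"
    by (simp add: P2_def image_UN targets_bb_step2)
  have S3: "fst ` set P3 = (\<Union>j\<in>{0..int n - 2}. fst ` set (row j))"
    by (simp add: P3_def image_UN)
  have "computes ?val ?K P1"
    unfolding P1_def by (rule computes_concat_independent) (auto intro!: computes_bb_step1)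
  moreover have "computes ?val (?K \<union> fst ` set P1) P2"
    unfolding P2_def
  proof (rule computes_concat_downto)
    fix i assume i: "int n - int m \<le> i" "i \<le> int n - 2"
    let ?D = "?K \<union> fst ` set P1 \<union> (\<Union>y\<in>{i + 1..int n - 2}. fst ` set (bb_step2 m (int n) y))"
    have "coef_regs m (i + 1) (int n - 1) \<subseteq> ?D"
    proof (cases "i + 1 = int n - 1")
      case True
      have "int n - 1 \<in> {0..int n - 1}" using n by simp
      then show ?thesis unfolding S1 True by blast
    next
      case False
      then have "i + 1 \<in> {i + 1..int n - 2}" using i by simp
      then show ?thesis unfolding targets_bb_step2 by blast
    qed
    then show "computes ?val ?D (bb_step2 m (int n) i)"
      by (intro computes_bb_step2[OF i]) blast+
  qed
  moreover have "computes ?val (?K \<union> fst ` set P1 \<union> fst ` set P2) P3"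
    unfolding P3_def
  proof (rule computes_concat_downto)
    fix j assume j: "0 \<le> j" "j \<le> int n - 2"
    let ?E = "?K \<union> fst ` set P1 \<union> fst ` set P2 \<union> (\<Union>y\<in>{j + 1..int n - 2}. fst ` set (row y))"
    show "computes ?val ?E (row j)"
      unfolding row_def[of j]
    proof (rule computes_concat_downto)
      fix i assume i: "j - int m + 1 \<le> i" "i \<le> j - 1"
      let ?D = "?E \<union> (\<Union>y\<in>{i + 1..j - 1}. fst ` set (bb_step3 m j y))"
      have "coef_regs m (i + 1) j \<subseteq> ?D"
      proof (cases "i + 1 = j")
        case True
        have "j \<in> {0..int n - 1}" using j by simp
        then show ?thesis unfolding S1 True by blast
      next
        case False
        then have "i + 1 \<in> {i + 1..j - 1}" using i by simp
        then show ?thesis unfolding targets_bb_step3 by blast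
      qed
      moreover have "coef_regs m i (j + 1) \<subseteq> ?E"
      proof -
        consider "i = j + 1 - int m" | "j + 1 = int n - 1" "i \<in> {int n - int m..int n - 2}"
          | "j + 1 \<in> {j + 1..int n - 2}" "i \<in> {j + 1 - int m + 1..j + 1 - 1}"
          using i j by force
        then show ?thesis
        proof cases
          case 1
          have "j + 1 \<in> {0..int n - 1}" using j by simp
          then show ?thesis unfolding S1 1 by blast
        next
          case 2
          show ?thesis unfolding S2 2(1) using 2(2) by blast
        next
          case 3
          then show ?thesis unfolding row by blast
        qed
      qed
      moreover have "Coef i (j + 1) 0 \<in> coef_regs m i (j + 1)" by (simp add: coef_regs_def)
      ultimately show "computes ?val ?D (bb_step3 m j i)"
        by (intro computes_bb_step3[OF j i]) blast+
    qed
  qed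
  ultimately have "computes ?val ?K (bb_program m n)"
    unfolding program by (intro computes_append) auto
  moreover have "agrees ?val ?K (knot_state m n t)"
    by (auto simp: agrees_def knot_regs_def)
  ultimately obtain s where s: "execute (bb_program m n) (knot_state m n t) = Some s"
      "agrees ?val (?K \<union> fst ` set (bb_program m n)) s"
    unfolding computes_def by blast
  have "s (Coef i j k) = Some (bb_coeff t m i j k)"
    if j: "j \<in> {0..int n - 1}" and i: "i \<in> {j - int m..j}" and k: "k \<in> {0..m}" for i j k
  proof -
    consider "i = j" | "i = j - int m" | "j = int n - 1" "i \<in> {int n - int m..int n - 2}"
      | "j \<in> {0..int n - 2}" "i \<in> {j - int m + 1..j - 1}"
      using i j by force
    then have "coef_regs m i j \<subseteq> fst ` set (bb_program m n)"
    proof cases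
      case 1
      then show ?thesis unfolding program set_append image_Un S1 using j by blast
    next
      case 2
      then show ?thesis unfolding program set_append image_Un S1 using j by blast
    next
      case 3
      show ?thesis unfolding program set_append image_Un S2 3(1) using 3(2) by blast
    next
      case 4
      then show ?thesis unfolding program set_append image_Un S3 row by blast
    qed
    moreover have "Coef i j k \<in> coef_regs m i j" using k by (simp add: coef_regs_def)
    ultimately show ?thesis using agreesD[OF s(2), of "Coef i j k"] by auto
  qed
  with s(1) show ?thesis by blast
qed

end

theorem theorem4p4:
  shows "(\<exists>C::nat. \<forall>m n::nat. m \<ge> 1 \<longrightarrow> n \<ge> 1 \<longrightarrow> program_ops (bb_program m n) \<le> C * (n * m\<^sup>2)) \<and>
   (\<forall>(m::nat) (n::nat) (t :: int \<Rightarrow> real). m \<ge> 1 \<longrightarrow> n \<ge> 1 \<longrightarrow> clamped_knots m n t \<longrightarrow>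
    (let b = bb_coeff t m; M = int m; N = int n in
      (\<exists>s. execute (bb_program m n) (knot_state m n t) = Some s \<and>
        (\<forall>j\<in>{0..N - 1}. \<forall>i\<in>{j - M..j}. \<forall>k\<in>{0..m}. s (Coef i j k) = Some (b i j k))) \<and>
      (\<forall>j\<in>{0..N - 1}.
        (\<forall>k<m. b j j k = 0) \<and>
        b j j m = (t (j + 1) - t j) ^ (m - 1) / (\<Prod>k=2..m. t (j + int k) - t j) \<and>
        b (j - M) j 0 = (t (j + 1) - t j) ^ (m - 1) / (\<Prod>k=2..m. t (j + 1) - t (j + 1 - int k)) \<and>
        (\<forall>k\<in>{1..m}. b (j - M) j k = 0)) \<and>
      (\<forall>i\<in>{N - M..N - 2}.
        b i (N - 1) m = 0 \<and>
        (\<forall>k<m.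
          b i (N - 1) k =
            (t (N - 1) - t i) / (t N - t i) * b i (N - 1) (k + 1)
            + (t N - t (N - 1)) / (t N - t (i + 1)) * b (i + 1) (N - 1) (k + 1) \<and>
          b i (N - 1) k =
            (t N - t (N - 1)) / (t N - t (i + 1)) *
            (\<Sum>l=0..m - k - 1. ((t (N - 1) - t i) / (t N - t i)) ^ l * b (i + 1) (N - 1) (k + 1 + l)))) \<and>
      (\<forall>j\<in>{0..N - 2}. \<forall>i\<in>{j - M + 1..j - 1}.
        let v = (t (M + i + 1) - t i) / (t (M + i + 2) - t (i + 1));
            q = (\<lambda>l. (t (j + 1) - t (M + i + 2)) * b (i + 1) j l
                     + (t (M + i + 2) - t j) * b (i + 1) j (l + 1))
        in
        b i j m = b i (j + 1) 0 \<and>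
        (\<forall>k<m.
          b i j k =
            (t j - t i) / (t (j + 1) - t i) * b i j (k + 1)
            + v / (t (j + 1) - t i) *
              ((t (j + 1) - t (M + i + 2)) * b (i + 1) j k
               + (t (M + i + 2) - t j) * b (i + 1) j (k + 1)) \<and>
          b i j k =
            ((t j - t i) / (t (j + 1) - t i)) ^ (m - k) * b i (j + 1) 0
            + (\<Sum>l=0..m - k - 1. ((t j - t i) / (t (j + 1) - t i)) ^ l
                 * (v / (t (j + 1) - t i)) * q (k + l))))))"
proof (intro conjI exI[of _ 33] allI impI)
  fix m n :: nat
  assume "1 \<le> m" "1 \<le> n"
  then show "program_ops (bb_program m n) \<le> 33 * (n * m\<^sup>2)" by (rule program_ops_bb_program)
next
  fix m n :: nat and t :: "int \<Rightarrow> real"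
  assume asms: "1 \<le> m" "1 \<le> n" "clamped_knots m n t"
  show "let b = bb_coeff t m; M = int m; N = int n in
      (\<exists>s. execute (bb_program m n) (knot_state m n t) = Some s \<and>
        (\<forall>j\<in>{0..N - 1}. \<forall>i\<in>{j - M..j}. \<forall>k\<in>{0..m}. s (Coef i j k) = Some (b i j k))) \<and>
      (\<forall>j\<in>{0..N - 1}.
        (\<forall>k<m. b j j k = 0) \<and>
        b j j m = (t (j + 1) - t j) ^ (m - 1) / (\<Prod>k=2..m. t (j + int k) - t j) \<and>
        b (j - M) j 0 = (t (j + 1) - t j) ^ (m - 1) / (\<Prod>k=2..m. t (j + 1) - t (j + 1 - int k)) \<and>
        (\<forall>k\<in>{1..m}. b (j - M) j k = 0)) \<and>
      (\<forall>i\<in>{N - M..N - 2}.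
        b i (N - 1) m = 0 \<and>
        (\<forall>k<m.
          b i (N - 1) k =
            (t (N - 1) - t i) / (t N - t i) * b i (N - 1) (k + 1)
            + (t N - t (N - 1)) / (t N - t (i + 1)) * b (i + 1) (N - 1) (k + 1) \<and>
          b i (N - 1) k =
            (t N - t (N - 1)) / (t N - t (i + 1)) *
            (\<Sum>l=0..m - k - 1. ((t (N - 1) - t i) / (t N - t i)) ^ l * b (i + 1) (N - 1) (k + 1 + l)))) \<and>
      (\<forall>j\<in>{0..N - 2}. \<forall>i\<in>{j - M + 1..j - 1}.
        let v = (t (M + i + 1) - t i) / (t (M + i + 2) - t (i + 1));
            q = (\<lambda>l. (t (j + 1) - t (M + i + 2)) * b (i + 1) j l
                     + (t (M + i + 2) - t j) * b (i + 1) j (l + 1))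
        in
        b i j m = b i (j + 1) 0 \<and>
        (\<forall>k<m.
          b i j k =
            (t j - t i) / (t (j + 1) - t i) * b i j (k + 1)
            + v / (t (j + 1) - t i) *
              ((t (j + 1) - t (M + i + 2)) * b (i + 1) j k
               + (t (M + i + 2) - t j) * b (i + 1) j (k + 1)) \<and>
          b i j k =
            ((t j - t i) / (t (j + 1) - t i)) ^ (m - k) * b i (j + 1) 0
            + (\<Sum>l=0..m - k - 1. ((t j - t i) / (t (j + 1) - t i)) ^ l
                 * (v / (t (j + 1) - t i)) * q (k + l))))"
    unfolding Let_def
  proof (intro conjI)
    show "\<exists>s. execute (bb_program m n) (knot_state m n t) = Some s \<and>
        (\<forall>j\<in>{0..int n - 1}. \<forall>i\<in>{j - int m..j}. \<forall>k\<in>{0..m}. s (Coef i j k) = Some (bb_coeff t m i j k))"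
      by (rule execute_bb_program[OF asms])
  next
    show "\<forall>j\<in>{0..int n - 1}.
        (\<forall>k<m. bb_coeff t m j j k = 0) \<and>
        bb_coeff t m j j m = (t (j + 1) - t j) ^ (m - 1) / (\<Prod>k=2..m. t (j + int k) - t j) \<and>
        bb_coeff t m (j - int m) j 0 = (t (j + 1) - t j) ^ (m - 1) / (\<Prod>k=2..m. t (j + 1) - t (j + 1 - int k)) \<and>
        (\<forall>k\<in>{1..m}. bb_coeff t m (j - int m) j k = 0)"
      using bb_coeff_last_support[OF asms] bb_coeff_first_support[OF asms] by simp
  qed ((intro ballI conjI allI impI,
      (rule bb_coeff_right_end[OF asms]; simp),
      (rule bb_coeff_last_span_recurrence[OF asms]; simp),
      (rule bb_coeff_last_span_explicit[OF asms]; simp)),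
    (intro ballI conjI allI impI,
      (rule bb_coeff_continuous[OF asms]; simp),
      (rule bb_coeff_recurrence[OF asms]; simp),
      (rule bb_coeff_explicit[OF asms]; simp)))
qed

end
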